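(* For any $\epsilon>0$, there is a two-sided adaptive algorithm for $\epsilon$-testing size-$s$ Boolean Formula with respect to the uniform distribution that makes $\tilde O(s/\epsilon)$ queries.
   Context: Boolean functions $f:\{0,1\}^n\to\{0,1\}$ are accessed through a membership-query oracle that returns $f(x)$ for a queried $x$. $f$ is $\epsilon$-far from a class $C$ (with respect to the uniform distribution) if $\Pr_{x}[f(x)\neq g(x)]\ge\epsilon$ for every $g\in C$, with $x$ uniform on $\{0,1\}^n$. A two-sided adaptive algorithm for $\epsilon$-testing $C$ is a randomized algorithm that, given $\epsilon$ and membership-query access to an arbitrary $f$ (and able to draw uniform random strings), chooses queries possibly adaptively, accepts with probability at least $2/3$ if $f\in C$, and rejects with probability at least $2/3$ if $f$ is $\epsilon$-far from every function in $C$. $\tilde O(T)$ means $O(T\cdot\mathrm{poly}(\log T))$. A Boolean formula is a rooted tree whose internal nodes have arbitrarily many children and are labeled AND or OR, and whose leaves are labeled by a variable $x_i$ or its negation; its size is the number of AND/OR gates. size-$s$ Boolean Formula is the class of Boolean formulas of size at most $s$. *)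

theory Defs
  imports "HOL-Probability.Probability" "HOL-Library.Landau_Symbols"
    "HOL-Computational_Algebra.Polynomial"
begin

(* The cube {0,1}^n. Boolean functions on it are total functions on bool lists; nothing
   below depends on their values at lists of a length different from n. *)
definition cube :: "nat \<Rightarrow> bool list set" where
  "cube n = {x. length x = n}"

lemma finite_cube [simp]: "finite (cube n)"
  using finite_lists_length_eq[of "UNIV :: bool set" n] by (simp add: cube_def)

lemma card_cube: "card (cube n) = 2 ^ n"
  using card_lists_length_eq[of "UNIV :: bool set" n] by (simp add: cube_def)

lemma cube_nonempty [simp]: "cube n \<noteq> {}"
  using card_cube[of n] by force

definition dist_unif :: "nat \<Rightarrow> (bool list \<Rightarrow> bool) \<Rightarrow> (bool list \<Rightarrow> bool) \<Rightarrow> real" where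
  "dist_unif n f g = measure_pmf.prob (pmf_of_set (cube n)) {x. f x \<noteq> g x}"

definition far :: "nat \<Rightarrow> real \<Rightarrow> (bool list \<Rightarrow> bool) \<Rightarrow> (bool list \<Rightarrow> bool) set \<Rightarrow> bool" where
  "far n \<epsilon> f C \<longleftrightarrow> (\<forall>g\<in>C. dist_unif n f g \<ge> \<epsilon>)"


(* Lit True i is the variable x_i, Lit False i is its negation. *)
datatype formula =
    Lit bool nat
  | And "formula list"
  | Or "formula list"

fun eval_formula :: "formula \<Rightarrow> bool list \<Rightarrow> bool" where
  "eval_formula (Lit b i) x = (if b then x ! i else \<not> x ! i)"
| "eval_formula (And \<phi>s) x = (\<forall>\<phi>\<in>set \<phi>s. eval_formula \<phi> x)"
| "eval_formula (Or \<phi>s) x = (\<exists>\<phi>\<in>set \<phi>s. eval_formula \<phi> x)"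

fun formula_size :: "formula \<Rightarrow> nat" where
  "formula_size (Lit b i) = 0"
| "formula_size (And \<phi>s) = Suc (\<Sum>\<phi>\<leftarrow>\<phi>s. formula_size \<phi>)"
| "formula_size (Or \<phi>s) = Suc (\<Sum>\<phi>\<leftarrow>\<phi>s. formula_size \<phi>)"

(* Gates are internal nodes of the tree, so they have at least one child. *)
fun formula_over :: "nat \<Rightarrow> formula \<Rightarrow> bool" where
  "formula_over n (Lit b i) \<longleftrightarrow> i < n"
| "formula_over n (And \<phi>s) \<longleftrightarrow> \<phi>s \<noteq> [] \<and> (\<forall>\<phi>\<in>set \<phi>s. formula_over n \<phi>)"
| "formula_over n (Or \<phi>s) \<longleftrightarrow> \<phi>s \<noteq> [] \<and> (\<forall>\<phi>\<in>set \<phi>s. formula_over n \<phi>)"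

definition formula_class :: "nat \<Rightarrow> nat \<Rightarrow> (bool list \<Rightarrow> bool) set" where
  "formula_class n s = {f. \<exists>\<phi>. formula_over n \<phi> \<and> formula_size \<phi> \<le> s \<and>
                               (\<forall>x\<in>cube n. f x = eval_formula \<phi> x)}"


(* A randomized adaptive query algorithm, as the tree of its possible runs: Query x k asks
   the oracle for f x and continues with k (f x); Draw m k draws a uniform random string of
   length m and continues with it. Only queries are charged. *)
datatype algorithm =
    Answer bool
  | Query "bool list" "bool \<Rightarrow> algorithm"
  | Draw nat "bool list \<Rightarrow> algorithm"

primrec run :: "algorithm \<Rightarrow> (bool list \<Rightarrow> bool) \<Rightarrow> bool pmf" where
  "run (Answer b) f = return_pmf b"
| "run (Query x k) f = run (k (f x)) f"
| "run (Draw m k) f = bind_pmf (pmf_of_set (cube m)) (\<lambda>r. run (k r) f)"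

(* Worst case over oracle answers and random draws; all queries must be points of cube n. *)
inductive queries_at_most :: "nat \<Rightarrow> algorithm \<Rightarrow> nat \<Rightarrow> bool" for n where
  "queries_at_most n (Answer b) q"
| "x \<in> cube n \<Longrightarrow> (\<And>b. queries_at_most n (k b) q) \<Longrightarrow> queries_at_most n (Query x k) (Suc q)"
| "(\<And>r. r \<in> cube m \<Longrightarrow> queries_at_most n (k r) q) \<Longrightarrow> queries_at_most n (Draw m k) q"

definition two_sided_tester ::
    "nat \<Rightarrow> real \<Rightarrow> (bool list \<Rightarrow> bool) set \<Rightarrow> algorithm \<Rightarrow> bool" where
  "two_sided_tester n \<epsilon> C A \<longleftrightarrow>
     (\<forall>f. (f \<in> C \<longrightarrow> pmf (run A f) True \<ge> 2 / 3) \<and>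
          (far n \<epsilon> f C \<longrightarrow> pmf (run A f) False \<ge> 2 / 3))"


(* Functions that are O(T * poly(log T)) with respect to the filter F. For F = principal S
   the bound holds, with one constant and one polynomial, at every point of S. *)
definition soft_O :: "'a filter \<Rightarrow> ('a \<Rightarrow> real) \<Rightarrow> ('a \<Rightarrow> real) set" where
  "soft_O F T = {f. \<exists>p :: real poly. f \<in> O[F](\<lambda>x. T x * poly p (ln (T x)))}"

end

theory Submission
  imports Defs
begin

text \<open>
  The variables are merged at random into \<open>r\<close> blocks, where \<open>r\<close> is polynomial in \<open>s / \<epsilon>\<close>, and
  \<open>f\<close> is shifted by a random string, so that each query is uniformly distributed. On \<open>r\<close> variables
  one can afford to look for a small formula that is consistent with random samples. Replacing each
  gate with more than \<open>L\<close> literal variables by a constant changes a formula of size \<open>s\<close> with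
  probability at most \<open>s / 2 ^ L\<close>, so the hypotheses have \<open>O(s L)\<close> nodes, and \<open>O(s / \<epsilon>)\<close> samples
  suffice up to logarithmic factors.

  A consistent hypothesis depends on few blocks. The tester also checks that \<open>f\<close> does not
  change when the variables outside of these blocks are drawn anew. If \<open>f\<close> is far from every junta, then
  for most partitions this check fails for every choice of few blocks. If \<open>f\<close> is close to a junta \<open>g\<close>,
  then the partition separates the variables of \<open>g\<close>, so that a good hypothesis for the restriction
  of \<open>g\<close> gives a formula close to \<open>g\<close> and to \<open>f\<close>.
\<close>

section \<open>Probabilities of events\<close>

text \<open>The blocks named by a hypothesis depend on the samples, so
  \<open>random_partition\<close> has to cover all small sets of blocks at once. A union bound over
  up to r^k sets of k blocks needs probabilities well below r^(-k) for each. They come from the fact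
  that any two members of the relevant family meet in 2 * k variables, which bounds its measure by
  (2 * k / r)^(2 * k). The accuracy \<alpha> = \<epsilon> / 20000 is much finer than the distance
  \<epsilon> to be detected: for f in the class, the selected consistent hypothesis need not be the
  true one, and none of about 480 / \<epsilon> pairs may reveal the difference. The gap between f
  and its approximation is treated in two ways. For f in the class, the narrowed formula is so close
  that with good probability no query hits the difference; hence 2^L has to exceed the number of
  queries times s. For f near a junta, the distance may be of order \<epsilon> and many samples may
  hit it. The random shift carries this distance over to the block cube on average, and Markov's
  inequality loses only a constant factor.\<close>

abbreviation Pr :: "'a pmf \<Rightarrow> ('a \<Rightarrow> bool) \<Rightarrow> real" where
  "Pr M Q \<equiv> measure_pmf.prob M {x. Q x}"

abbreviation unif :: "nat \<Rightarrow> bool list pmf" where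
  "unif n \<equiv> pmf_of_set (cube n)"

lemma Pr_mono: "(\<And>x. x \<in> set_pmf M \<Longrightarrow> Q x \<Longrightarrow> R x) \<Longrightarrow> Pr M Q \<le> Pr M R"
  by (intro measure_pmf.finite_measure_mono_AE) (auto simp: AE_measure_pmf_iff)

lemma Pr_cong: "(\<And>x. x \<in> set_pmf M \<Longrightarrow> Q x \<longleftrightarrow> R x) \<Longrightarrow> Pr M Q = Pr M R"
  by (intro antisym Pr_mono) auto

lemma Pr_disj: "Pr M (\<lambda>x. Q x \<or> R x) \<le> Pr M Q + Pr M R"
  using measure_Un_le[of "{x. Q x}" M "{x. R x}"] by (simp add: Collect_disj_eq)

lemma Pr_le_disj:
  assumes "\<And>x. x \<in> set_pmf M \<Longrightarrow> A x \<Longrightarrow> Q x \<or> R x" "Pr M Q \<le> a" "Pr M R \<le> b"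
  shows "Pr M A \<le> a + b"
  using Pr_mono[of M A "\<lambda>x. Q x \<or> R x"] Pr_disj[of M Q R] assms by force

lemma Pr_not: "Pr M (\<lambda>x. \<not> Q x) = 1 - Pr M Q"
  using measure_pmf.prob_compl[of "{x. Q x}" M] by (simp add: Compl_eq_Diff_UNIV[symmetric] Collect_neg_eq)

lemma Pr_map: "Pr (map_pmf g M) Q = Pr M (\<lambda>x. Q (g x))"
  by (simp add: vimage_def)

lemma pmf_eq_Pr: "pmf M c = Pr M (\<lambda>x. x = c)"
  by (simp add: measure_pmf_single)

lemma Pr_const [simp]: "Pr M (\<lambda>x. c) = of_bool c"
  by (cases c) auto

lemma Pr_UN_list:
  assumes "\<And>y. y \<in> set ys \<Longrightarrow> Pr M (\<lambda>x. R x y) \<le> c y"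
  shows "Pr M (\<lambda>x. \<exists>y\<in>set ys. R x y) \<le> (\<Sum>y\<leftarrow>ys. c y)"
  using assms
proof (induction ys)
  case (Cons a ys)
  have "Pr M (\<lambda>x. \<exists>y\<in>set (a # ys). R x y) \<le> c a + (\<Sum>y\<leftarrow>ys. c y)"
    by (rule Pr_le_disj[where Q = "\<lambda>x. R x a" and R = "\<lambda>x. \<exists>y\<in>set ys. R x y"]) (use Cons in auto)
  then show ?case by simp
qed auto

lemma Pr_UN_set:
  assumes "finite A" "\<And>y. y \<in> A \<Longrightarrow> Pr M (\<lambda>x. R x y) \<le> c" "real (card A) * c \<le> d"
  shows "Pr M (\<lambda>x. \<exists>y\<in>A. R x y) \<le> d"
proof -
  obtain ys where ys: "set ys = A" "distinct ys"
    using finite_distinct_list[OF assms(1)] by auto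
  have "Pr M (\<lambda>x. \<exists>y\<in>set ys. R x y) \<le> (\<Sum>y\<leftarrow>ys. c)"
    by (rule Pr_UN_list) (use assms ys in auto)
  also have "\<dots> = real (card A) * c"
    using ys distinct_card[of ys] by (simp add: sum_list_triv)
  finally show ?thesis using ys assms by simp
qed

section \<open>Independent draws: products and repeated samples\<close>

lemma Pr_pair: "Pr (pair_pmf M N) Q = measure_pmf.expectation M (\<lambda>x. Pr N (\<lambda>y. Q (x, y)))"
proof -
  have "ennreal (Pr (pair_pmf M N) Q) = emeasure (pair_pmf M N) {x. Q x}"
    by (simp add: measure_pmf.emeasure_eq_measure)
  also have "\<dots> = (\<integral>\<^sup>+x. indicator {x. Q x} x \<partial>pair_pmf M N)"
    by simp
  also have "\<dots> = (\<integral>\<^sup>+x. \<integral>\<^sup>+y. indicator {x. Q x} (x, y) \<partial>N \<partial>M)"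
    by (rule nn_integral_pair_pmf')
  also have "\<dots> = (\<integral>\<^sup>+x. \<integral>\<^sup>+y. indicator {y. Q (x, y)} y \<partial>N \<partial>M)"
    by (intro nn_integral_cong) (auto simp: indicator_def)
  also have "\<dots> = (\<integral>\<^sup>+x. ennreal (Pr N (\<lambda>y. Q (x, y))) \<partial>M)"
    by (simp add: measure_pmf.emeasure_eq_measure)
  also have "\<dots> = ennreal (measure_pmf.expectation M (\<lambda>x. Pr N (\<lambda>y. Q (x, y))))"
    by (intro nn_integral_eq_integral measure_pmf.integrable_const_bound[where B = 1]) auto
  finally show ?thesis
    by (subst (asm) ennreal_inj) (auto intro!: integral_nonneg_AE)
qed

lemma integrable_Pr [simp]: "integrable (measure_pmf M) (\<lambda>x. Pr (N x) (Q x))"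
  by (intro measure_pmf.integrable_const_bound[where B = 1]) auto

text \<open>A union bound without conditional probabilities: the inner probability is at most the
  indicator of the bad event B plus c. The error analyses below peel off one random draw after the
  other in this way.\<close>

lemma Pr_pair_le:
  assumes "Pr M B \<le> a" "c \<ge> 0"
    "\<And>x. x \<in> set_pmf M \<Longrightarrow> \<not> B x \<Longrightarrow> Pr N (\<lambda>y. Q (x, y)) \<le> c"
  shows "Pr (pair_pmf M N) Q \<le> a + c"
proof -
  have "Pr (pair_pmf M N) Q \<le> measure_pmf.expectation M (\<lambda>x. indicator {x. B x} x + c)"
    unfolding Pr_pair
  proof (intro integral_mono_AE)
    show "AE x in measure_pmf M. Pr N (\<lambda>y. Q (x, y)) \<le> indicator {x. B x} x + c"
      using assms by (auto simp: AE_measure_pmf_iff indicator_def intro: add_increasing2)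
  qed (auto intro!: Bochner_Integration.integrable_add simp: integrable_indicator_iff measure_pmf.emeasure_eq_measure)
  also have "\<dots> = Pr M B + c"
    by (subst Bochner_Integration.integral_add) (auto simp: integrable_indicator_iff measure_pmf.emeasure_eq_measure)
  finally show ?thesis using assms by simp
qed

lemma Pr_pair_le_uniform:
  assumes "\<And>x. x \<in> set_pmf M \<Longrightarrow> Pr N (\<lambda>y. Q (x, y)) \<le> c"
  shows "Pr (pair_pmf M N) Q \<le> c"
proof -
  obtain x where "x \<in> set_pmf M" using set_pmf_not_empty by fast
  from assms[OF this] have "c \<ge> 0" by (rule order_trans[rotated]) auto
  with Pr_pair_le[of M "\<lambda>_. False" 0 c N Q] assms show ?thesis by simp
qed

lemma Pr_pair_swap: "Pr (pair_pmf M N) Q = Pr (pair_pmf N M) (\<lambda>(y, x). Q (x, y))"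
  by (subst pair_commute_pmf) (simp add: Pr_map case_prod_unfold del: measure_map_pmf)

lemma Pr_pair_Markov:
  assumes "c > 0" "Pr (pair_pmf M N) Q \<le> c * a"
  shows "Pr M (\<lambda>x. c \<le> Pr N (\<lambda>y. Q (x, y))) \<le> a"
proof -
  have "Pr M (\<lambda>x. c \<le> Pr N (\<lambda>y. Q (x, y)))
      \<le> measure_pmf.expectation M (\<lambda>x. Pr N (\<lambda>y. Q (x, y))) / c"
    using integral_Markov_inequality_measure[of M "\<lambda>x. Pr N (\<lambda>y. Q (x, y))" UNIV c] assms
    by simp
  also have "\<dots> \<le> a" using assms by (simp add: Pr_pair field_simps)
  finally show ?thesis .
qed

text \<open>Averaging argument, used to fix auxiliary random strings. If every x exceeded the
  average, a strictly positive function would have integral zero.\<close>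

lemma Pr_pair_ex_le: "\<exists>x\<in>set_pmf M. Pr N (\<lambda>y. Q (x, y)) \<le> Pr (pair_pmf M N) Q"
proof (rule ccontr)
  let ?E = "Pr (pair_pmf M N) Q"
  assume *: "\<not> ?thesis"
  have "measure_pmf.expectation M (\<lambda>x. Pr N (\<lambda>y. Q (x, y)) - ?E) = 0"
    by (subst Bochner_Integration.integral_diff) (auto simp: Pr_pair)
  then have "AE x in M. Pr N (\<lambda>y. Q (x, y)) - ?E = 0"
    using * by (subst (asm) integral_nonneg_eq_0_iff_AE) (auto simp: AE_measure_pmf_iff less_imp_le)
  with * show False
    using set_pmf_not_empty[of M] by (fastforce simp: AE_measure_pmf_iff)
qed

lemma replicate_pmf_Suc_pair:
  "replicate_pmf (Suc n) M = map_pmf (\<lambda>(x, xs). x # xs) (pair_pmf M (replicate_pmf n M))"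
  by (simp add: pair_pmf_def map_bind_pmf)

lemma set_replicate_pmf_length: "xs \<in> set_pmf (replicate_pmf n M) \<Longrightarrow> length xs = n"
  by (induction n arbitrary: xs) auto

lemma set_replicate_pmf_elem:
  "xs \<in> set_pmf (replicate_pmf n M) \<Longrightarrow> x \<in> set xs \<Longrightarrow> x \<in> set_pmf M"
  by (induction n arbitrary: xs) auto

lemma map_replicate_pmf: "map_pmf (map g) (replicate_pmf n M) = replicate_pmf n (map_pmf g M)"
proof (induction n)
  case (Suc n)
  show ?case
    by (simp only: replicate_pmf_Suc_pair Suc[symmetric] pmf.map_comp map_pair[symmetric])
      (simp add: o_def case_prod_unfold)
qed simp

lemma Pr_pair_conj: "Pr (pair_pmf M N) (\<lambda>(x, y). Q x \<and> R y) = Pr M Q * Pr N R"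
proof -
  have "Pr N (\<lambda>y. Q x \<and> R y) = indicator {x. Q x} x * Pr N R" for x
    by (cases "Q x") auto
  then show ?thesis by (simp only: Pr_pair prod.case) simp
qed

lemma Pr_replicate_all: "Pr (replicate_pmf m M) (\<lambda>xs. \<forall>x\<in>set xs. Q x) = Pr M Q ^ m"
proof (induction m)
  case (Suc m)
  have "Pr (replicate_pmf (Suc m) M) (\<lambda>xs. \<forall>x\<in>set xs. Q x) =
     Pr (pair_pmf M (replicate_pmf m M)) (\<lambda>(x, xs). Q x \<and> (\<forall>x\<in>set xs. Q x))"
    by (simp only: replicate_pmf_Suc_pair Pr_map) (simp add: case_prod_unfold)
  also have "\<dots> = Pr M Q ^ Suc m" by (subst Pr_pair_conj) (simp add: Suc)
  finally show ?case .
qed simp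

lemma Pr_replicate_all_le:
  assumes "a \<le> Pr M (\<lambda>x. \<not> Q x)" "ln (1 / c) \<le> a * real m" "c > 0"
  shows "Pr (replicate_pmf m M) (\<lambda>xs. \<forall>x\<in>set xs. Q x) \<le> c"
proof -
  have "Pr M Q \<le> 1 - a" using assms Pr_not[of M Q] by simp
  also have "\<dots> \<le> exp (- a)" using exp_ge_add_one_self[of "- a"] by simp
  finally have "Pr M Q ^ m \<le> exp (- a) ^ m" by (intro power_mono) auto
  also have "\<dots> = exp (- (a * real m))" by (simp add: exp_of_nat_mult[symmetric] mult_ac)
  also have "\<dots> \<le> exp (- ln (1 / c))" using assms by simp
  also have "\<dots> = c" using assms by (simp add: ln_div)
  finally show ?thesis by (simp add: Pr_replicate_all)
qed

lemma Pr_replicate_ex_le: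
  assumes "Pr M Q \<le> c" "real m * c \<le> d"
  shows "Pr (replicate_pmf m M) (\<lambda>xs. \<exists>x\<in>set xs. Q x) \<le> d"
proof -
  have "Pr (replicate_pmf m M) (\<lambda>xs. \<exists>x\<in>set xs. Q x) = 1 - (1 - Pr M Q) ^ m"
    using Pr_not[of "replicate_pmf m M" "\<lambda>xs. \<forall>x\<in>set xs. \<not> Q x"]
    by (simp add: Pr_replicate_all Pr_not)
  also have "\<dots> \<le> real m * Pr M Q"
    using Bernoulli_inequality[of "- Pr M Q" m] by simp
  also have "\<dots> \<le> real m * c" using assms by (intro mult_left_mono) auto
  finally show ?thesis using assms by simp
qed

text \<open>For i = 0 the tail is drawn first, so that the head has to hit one fixed value;
  otherwise both entries lie in the tail.\<close>

lemma Pr_nth_collision: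
  assumes "\<And>c. pmf M c \<le> p" "i < j" "j < n"
  shows "Pr (replicate_pmf n M) (\<lambda>xs. xs ! i = xs ! j) \<le> p"
  using assms(2,3)
proof (induction n arbitrary: i j)
  case (Suc n)
  obtain j' where j: "j = Suc j'" using Suc.prems by (cases j) auto
  show ?case
  proof (cases i)
    case 0
    have "Pr (replicate_pmf (Suc n) M) (\<lambda>xs. xs ! i = xs ! j) =
        Pr (pair_pmf M (replicate_pmf n M)) (\<lambda>(x, xs). x = xs ! j')"
      by (simp only: replicate_pmf_Suc_pair Pr_map) (simp add: 0 j case_prod_unfold)
    also have "\<dots> = Pr (pair_pmf (replicate_pmf n M) M) (\<lambda>(xs, x). x = xs ! j')"
      by (subst Pr_pair_swap) (simp add: case_prod_unfold)
    also have "\<dots> \<le> p"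
      by (rule Pr_pair_le_uniform) (use assms(1) in \<open>simp add: measure_pmf_single\<close>)
    finally show ?thesis .
  next
    case (Suc i')
    have "Pr (replicate_pmf (Suc n) M) (\<lambda>xs. xs ! i = xs ! j) =
        Pr (pair_pmf M (replicate_pmf n M)) (\<lambda>(x, xs). xs ! i' = xs ! j')"
      by (simp only: replicate_pmf_Suc_pair Pr_map) (simp add: Suc j case_prod_unfold)
    also have "\<dots> \<le> p"
      by (rule Pr_pair_le_uniform) (use Suc.IH[of i' j'] Suc.prems Suc j in simp)
    finally show ?thesis .
  qed
qed simp

lemma Pr_not_inj_on:
  assumes "\<And>c. pmf M c \<le> p" "p \<ge> 0" "A \<subseteq> {..<n}" "real (card A) ^ 2 * p \<le> d"
  shows "Pr (replicate_pmf n M) (\<lambda>xs. \<not> inj_on ((!) xs) A) \<le> d"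
proof -
  let ?I = "{(i, j) \<in> A \<times> A. i < j}"
  have fin: "finite A" using assms finite_subset by blast
  have "Pr (replicate_pmf n M) (\<lambda>xs. \<not> inj_on ((!) xs) A)
     \<le> Pr (replicate_pmf n M) (\<lambda>xs. \<exists>ij\<in>?I. xs ! fst ij = xs ! snd ij)"
  proof (rule Pr_mono)
    fix xs :: "'a list" assume "\<not> inj_on ((!) xs) A"
    then obtain i j where "i \<in> A" "j \<in> A" "xs ! i = xs ! j" "i \<noteq> j" by (auto simp: inj_on_def)
    then show "\<exists>ij\<in>?I. xs ! fst ij = xs ! snd ij"
      by (intro bexI[of _ "(min i j, max i j)"]) (auto simp: min_def max_def)
  qed
  also have "\<dots> \<le> d"
  proof (rule Pr_UN_set)
    show "finite ?I" by (rule finite_subset[of _ "A \<times> A"]) (use fin in auto)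
    have "card ?I \<le> card (A \<times> A)" by (rule card_mono) (use fin in auto)
    then have "real (card ?I) \<le> real (card A) ^ 2"
      unfolding card_cartesian_product power2_eq_square of_nat_mult[symmetric] of_nat_le_iff .
    then show "real (card ?I) * p \<le> d"
      using assms mult_right_mono[of "real (card ?I)" "real (card A) ^ 2" p] by simp
    show "Pr (replicate_pmf n M) (\<lambda>xs. xs ! fst ij = xs ! snd ij) \<le> p" if "ij \<in> ?I" for ij
      using that assms by (intro Pr_nth_collision) auto
  qed
  finally show ?thesis .
qed

section \<open>Translations and uniformity on the cube\<close>

definition xor_list :: "bool list \<Rightarrow> bool list \<Rightarrow> bool list" where
  "xor_list = map2 (\<noteq>)"

lemma length_xor_list [simp]: "length (xor_list x y) = min (length x) (length y)"
  by (simp add: xor_list_def)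

lemma nth_xor_list [simp]:
  "i < length x \<Longrightarrow> i < length y \<Longrightarrow> xor_list x y ! i \<longleftrightarrow> x ! i \<noteq> y ! i"
  by (simp add: xor_list_def)

lemma map_unif_xor:
  assumes "a \<in> cube n" shows "map_pmf (\<lambda>x. xor_list x a) (unif n) = unif n"
proof (rule map_pmf_of_set_bij_betw)
  have "xor_list (xor_list x a) a = x" if "x \<in> cube n" for x
    using that assms by (auto simp: cube_def intro!: nth_equalityI)
  then show "bij_betw (\<lambda>x. xor_list x a) (cube n) (cube n)"
    by (intro bij_betwI[where g = "\<lambda>x. xor_list x a"]) (use assms in \<open>auto simp: cube_def\<close>)
qed auto

lemma set_pmf_unif [simp]: "set_pmf (unif n) = cube n"
  by (simp add: set_pmf_of_set)

text \<open>Only the uniform distribution on the cube is invariant under all translations. So it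
  suffices that each translation of the output is induced by a measure-preserving \<sigma> of the
  source. Projections, \<open>mix\<close>, \<open>pull\<close> and \<open>lift\<close> are all
  treated in this way.\<close>

lemma map_pmf_eq_unif_if_shift_invariant:
  assumes img: "\<And>x. x \<in> set_pmf M \<Longrightarrow> T x \<in> cube r"
    and shift: "\<And>v. v \<in> cube r \<Longrightarrow>
      \<exists>\<sigma>. map_pmf \<sigma> M = M \<and> (\<forall>x\<in>set_pmf M. T (\<sigma> x) = xor_list (T x) v)"
  shows "map_pmf T M = unif r"
proof -
  let ?N = "map_pmf T M"
  have const: "pmf ?N (xor_list u v) = pmf ?N u" if u: "u \<in> cube r" and v: "v \<in> cube r" for u v
  proof -
    obtain \<sigma> where \<sigma>: "map_pmf \<sigma> M = M" "\<And>x. x \<in> set_pmf M \<Longrightarrow> T (\<sigma> x) = xor_list (T x) v"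
      using shift[OF v] by blast
    have inj: "xor_list w v = xor_list u v \<longleftrightarrow> w = u" if "w \<in> cube r" for w
    proof
      assume "xor_list w v = xor_list u v"
      then have "xor_list (xor_list w v) v = xor_list (xor_list u v) v" by simp
      moreover have "xor_list (xor_list w v) v = w" if "w \<in> cube r" for w
        using that v by (auto simp: cube_def intro!: nth_equalityI)
      ultimately show "w = u" using that u by simp
    qed simp
    have "pmf ?N (xor_list u v) = Pr (map_pmf \<sigma> M) (\<lambda>x. T x = xor_list u v)"
      by (simp only: pmf_eq_Pr Pr_map \<sigma>(1))
    also have "\<dots> = Pr M (\<lambda>x. T (\<sigma> x) = xor_list u v)"
      by (simp only: Pr_map)
    also have "\<dots> = Pr M (\<lambda>x. T x = u)"
      by (rule Pr_cong) (simp add: \<sigma> inj img)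
    also have "\<dots> = pmf ?N u" by (simp only: pmf_eq_Pr Pr_map)
    finally show ?thesis .
  qed
  let ?z = "replicate r False"
  have z: "?z \<in> cube r" by (simp add: cube_def)
  have eq: "pmf ?N u = pmf ?N ?z" if "u \<in> cube r" for u
  proof -
    have "xor_list ?z u = u" using that by (auto simp: cube_def intro!: nth_equalityI)
    then show ?thesis using const[OF z that] by simp
  qed
  have "1 = (\<Sum>u\<in>cube r. pmf ?N u)"
    by (rule sum_pmf_eq_1[symmetric]) (use img in auto)
  also have "\<dots> = 2 ^ r * pmf ?N ?z" by (simp add: eq card_cube)
  finally have *: "pmf ?N ?z = 1 / 2 ^ r" by (simp add: field_simps)
  show ?thesis
  proof (rule pmf_eqI)
    fix u show "pmf ?N u = pmf (unif r) u"
    proof (cases "u \<in> cube r")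
      case True
      then show ?thesis using eq[OF True] by (simp add: * card_cube)
    next
      case False
      then have "u \<notin> set_pmf ?N" using img by auto
      then show ?thesis using False by (simp add: pmf_eq_0_set_pmf[THEN iffD2])
    qed
  qed
qed

lemma map_pair_unif_xor:
  assumes "a \<in> cube n" "a' \<in> cube n'"
  shows "map_pmf (map_prod (\<lambda>x. xor_list x a) (\<lambda>x. xor_list x a')) (pair_pmf (unif n) (unif n'))
    = pair_pmf (unif n) (unif n')"
  using map_pair[of "\<lambda>x. xor_list x a" "\<lambda>x. xor_list x a'" "unif n" "unif n'"] assms
  by (simp add: map_unif_xor map_prod_def)

lemma map_nth_unif:
  assumes "distinct vs" "set vs \<subseteq> {..<n}"
  shows "map_pmf (\<lambda>x. map ((!) x) vs) (unif n) = unif (length vs)"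
proof (rule map_pmf_eq_unif_if_shift_invariant)
  fix v :: "bool list" assume v: "v \<in> cube (length vs)"
  define a where "a = map (\<lambda>i. \<exists>j<length vs. vs ! j = i \<and> v ! j) [0..<n]"
  have a: "a ! (vs ! j) = v ! j" if "j < length vs" for j
  proof -
    have "vs ! j < n" using that assms(2) by (meson lessThan_iff nth_mem subsetD)
    then show ?thesis using that assms(1) by (auto simp: a_def nth_eq_iff_index_eq)
  qed
  have "a \<in> cube n" by (simp add: a_def cube_def)
  moreover have "map ((!) (xor_list x a)) vs = xor_list (map ((!) x) vs) v" if "x \<in> cube n" for x
  proof (rule nth_equalityI)
    fix j assume "j < length (map ((!) (xor_list x a)) vs)"
    then have "j < length vs" by simp
    moreover have "vs ! j < n" using \<open>j < length vs\<close> assms(2) by (meson lessThan_iff nth_mem subsetD)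
    ultimately show "map ((!) (xor_list x a)) vs ! j = xor_list (map ((!) x) vs) v ! j"
      using that v a \<open>a \<in> cube n\<close> by (simp add: cube_def)
  qed (use v in \<open>auto simp: cube_def\<close>)
  ultimately show "\<exists>\<sigma>. map_pmf \<sigma> (unif n) = unif n \<and>
      (\<forall>x\<in>set_pmf (unif n). map ((!) (\<sigma> x)) vs = xor_list (map ((!) x) vs) v)"
    by (intro exI[of _ "\<lambda>x. xor_list x a"]) (simp add: map_unif_xor)
qed (simp add: cube_def)

lemma Pr_subcube:
  assumes "finite I" "I \<subseteq> {..<n}"
  shows "Pr (unif n) (\<lambda>x. \<forall>i\<in>I. x ! i = c i) = (1 / 2) ^ card I"
proof -
  obtain vs where vs: "set vs = I" "distinct vs"
    using finite_distinct_list[OF assms(1)] by auto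
  have "Pr (unif n) (\<lambda>x. \<forall>i\<in>I. x ! i = c i) = Pr (unif n) (\<lambda>x. map ((!) x) vs = map c vs)"
    by (simp add: vs)
  also have "\<dots> = Pr (unif (length vs)) (\<lambda>u. u = map c vs)"
    by (subst map_nth_unif[of vs n, symmetric]) (use vs assms in \<open>simp_all only: Pr_map\<close>)
  also have "\<dots> = pmf (unif (length vs)) (map c vs)"
    by (simp only: pmf_eq_Pr)
  also have "\<dots> = (1 / 2) ^ card I"
    using distinct_card[of vs] vs by (simp add: card_cube power_divide) (simp add: cube_def)
  finally show ?thesis .
qed

section \<open>Formulas\<close>

fun fvars :: "formula \<Rightarrow> nat set" where
  "fvars (Lit b i) = {i}"
| "fvars (And \<phi>s) = (\<Union>\<phi>\<in>set \<phi>s. fvars \<phi>)"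
| "fvars (Or \<phi>s) = (\<Union>\<phi>\<in>set \<phi>s. fvars \<phi>)"

(* Empty gates are the constants: And [] is true, Or [] is false. They are free of charge here. *)
fun gsize :: "formula \<Rightarrow> nat" where
  "gsize (Lit b i) = 0"
| "gsize (And \<phi>s) = (if \<phi>s = [] then 0 else Suc (\<Sum>\<phi>\<leftarrow>\<phi>s. gsize \<phi>))"
| "gsize (Or \<phi>s) = (if \<phi>s = [] then 0 else Suc (\<Sum>\<phi>\<leftarrow>\<phi>s. gsize \<phi>))"

fun nodes :: "formula \<Rightarrow> nat" where
  "nodes (Lit b i) = 1"
| "nodes (And \<phi>s) = Suc (\<Sum>\<phi>\<leftarrow>\<phi>s. nodes \<phi>)"
| "nodes (Or \<phi>s) = Suc (\<Sum>\<phi>\<leftarrow>\<phi>s. nodes \<phi>)"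

text \<open>Negation occurs only at leaves, so the substitution is told the sign of a literal and
  has to supply both forms.\<close>

fun subst :: "(bool \<Rightarrow> nat \<Rightarrow> formula) \<Rightarrow> formula \<Rightarrow> formula" where
  "subst \<sigma> (Lit b i) = \<sigma> b i"
| "subst \<sigma> (And \<phi>s) = And (map (subst \<sigma>) \<phi>s)"
| "subst \<sigma> (Or \<phi>s) = Or (map (subst \<sigma>) \<phi>s)"

lemma sum_list_cong: "(\<And>x. x \<in> set xs \<Longrightarrow> f x = g x) \<Longrightarrow> (\<Sum>x\<leftarrow>xs. f x) = (\<Sum>x\<leftarrow>xs. g x)"
  by (metis map_cong)

lemma gsize_subst:
  "\<forall>i\<in>fvars \<phi>. \<forall>b. gsize (\<sigma> b i) = 0 \<Longrightarrow> gsize (subst \<sigma> \<phi>) = gsize \<phi>"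
  by (induction \<phi>) (auto intro!: sum_list_cong)

lemma nodes_subst:
  "\<forall>i\<in>fvars \<phi>. \<forall>b. nodes (\<sigma> b i) = 1 \<Longrightarrow> nodes (subst \<sigma> \<phi>) = nodes \<phi>"
  by (induction \<phi>) (auto intro!: sum_list_cong)

lemma fvars_subst:
  "\<forall>i\<in>fvars \<phi>. \<forall>b. fvars (\<sigma> b i) \<subseteq> V \<Longrightarrow> fvars (subst \<sigma> \<phi>) \<subseteq> V"
  by (induction \<phi>) (simp_all add: UN_subset_iff)

lemma eval_subst:
  "\<forall>i\<in>fvars \<phi>. \<forall>b. eval_formula (\<sigma> b i) x \<longleftrightarrow> b = y ! i \<Longrightarrow>
    eval_formula (subst \<sigma> \<phi>) x = eval_formula \<phi> y"
  by (induction \<phi>) simp_all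

lemma eval_formula_cong:
  "\<forall>i\<in>fvars \<phi>. x ! i = y ! i \<Longrightarrow> eval_formula \<phi> x = eval_formula \<phi> y"
  by (induction \<phi>) simp_all

text \<open>With c as the neutral value of the gate, True for \<open>And\<close> and False for
  \<open>Or\<close>, one argument serves both kinds of gate.\<close>

lemma eval_gate:
  assumes "G = And \<and> c \<or> G = Or \<and> \<not> c"
  shows "eval_formula (G \<phi>s) x = c \<longleftrightarrow> (\<forall>\<phi>\<in>set \<phi>s. eval_formula \<phi> x = c)"
  using assms by auto

lemma finite_fvars [simp]: "finite (fvars \<phi>)"
  by (induction \<phi>) auto

lemma card_fvars_le_nodes: "card (fvars \<phi>) \<le> nodes \<phi>"
proof -
  have *: "card (\<Union>\<phi>\<in>set \<phi>s. fvars \<phi>) \<le> (\<Sum>\<phi>\<leftarrow>\<phi>s. nodes \<phi>)"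
    if "\<And>\<phi>. \<phi> \<in> set \<phi>s \<Longrightarrow> card (fvars \<phi>) \<le> nodes \<phi>" for \<phi>s
    using that
  proof (induction \<phi>s)
    case (Cons a \<phi>s)
    have "card (\<Union>\<phi>\<in>set (a # \<phi>s). fvars \<phi>) \<le> card (fvars a) + card (\<Union>\<phi>\<in>set \<phi>s. fvars \<phi>)"
      by (simp add: card_Un_le)
    with Cons show ?case by (fastforce intro: order_trans)
  qed simp
  show ?thesis by (induction \<phi>) (auto intro!: le_SucI *)
qed

section \<open>Removing constants from formulas\<close>

lemma fvars_formula_over: "formula_over n \<phi> \<Longrightarrow> fvars \<phi> \<subseteq> {..<n}"
  by (induction \<phi>) auto

lemma formula_over_0: "\<not> formula_over 0 \<phi>"
  by (induction \<phi>) auto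

text \<open>\<open>formula_class\<close> admits no empty gates, so the constants that
  \<open>narrow\<close> and \<open>transfer\<close> introduce must disappear. At each gate, children
  equal to the neutral value are dropped; a child with the opposite value makes the gate constant,
  and so does the loss of all children.\<close>

lemma prune_constants:
  assumes "fvars \<phi> \<subseteq> {..<n}"
  shows "(\<exists>c. \<forall>x. eval_formula \<phi> x = c) \<or>
    (\<exists>\<psi>. formula_over n \<psi> \<and> formula_size \<psi> \<le> gsize \<phi> \<and> (\<forall>x. eval_formula \<psi> x = eval_formula \<phi> x))"
proof -
  let ?C = "\<lambda>\<phi>. \<exists>c. \<forall>x. eval_formula \<phi> x = c"
  let ?P = "\<lambda>\<phi> \<psi>. formula_over n \<psi> \<and> formula_size \<psi> \<le> gsize \<phi> \<and>
    (\<forall>x. eval_formula \<psi> x = eval_formula \<phi> x)"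
  have gate: "?C (G \<phi>s) \<or> (\<exists>\<psi>. ?P (G \<phi>s) \<psi>)"
    if G: "G = And \<and> c \<or> G = Or \<and> \<not> c" and IH: "\<And>\<phi>. \<phi> \<in> set \<phi>s \<Longrightarrow> ?C \<phi> \<or> (\<exists>\<psi>. ?P \<phi> \<psi>)"
    for G c \<phi>s
  proof -
    define p where "p \<phi> = (SOME \<psi>. ?P \<phi> \<psi>)" for \<phi>
    define \<phi>s' where "\<phi>s' = filter (\<lambda>\<phi>. \<not> ?C \<phi>) \<phi>s"
    have p: "?P \<phi> (p \<phi>)" if "\<phi> \<in> set \<phi>s'" for \<phi>
    proof -
      have "\<exists>\<psi>. ?P \<phi> \<psi>" using IH[of \<phi>] that unfolding \<phi>s'_def set_filter by blast
      then show ?thesis unfolding p_def by (rule someI_ex)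
    qed
    have "(\<Sum>\<phi>\<leftarrow>\<phi>s'. formula_size (p \<phi>)) \<le> (\<Sum>\<phi>\<leftarrow>\<phi>s'. gsize \<phi>)"
      by (rule sum_list_mono) (use p in blast)
    also have "\<dots> \<le> (\<Sum>\<phi>\<leftarrow>\<phi>s. gsize \<phi>)"
      unfolding \<phi>s'_def by (rule sum_list_filter_le_nat)
    finally have size: "(\<Sum>\<phi>\<leftarrow>\<phi>s'. formula_size (p \<phi>)) \<le> (\<Sum>\<phi>\<leftarrow>\<phi>s. gsize \<phi>)" .
    note eval = eval_gate[OF G]
    consider \<phi> where "\<phi> \<in> set \<phi>s" "\<forall>x. eval_formula \<phi> x = (\<not> c)"
      | "\<forall>\<phi>\<in>set \<phi>s. \<forall>x. eval_formula \<phi> x = c"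
      | "\<phi>s' \<noteq> []" "\<And>\<phi>. \<phi> \<in> set \<phi>s \<Longrightarrow> \<phi> \<in> set \<phi>s' \<or> (\<forall>x. eval_formula \<phi> x = c)"
    proof (cases "\<exists>\<phi>\<in>set \<phi>s. \<forall>x. eval_formula \<phi> x = (\<not> c)")
      case False
      have "\<phi> \<in> set \<phi>s' \<or> (\<forall>x. eval_formula \<phi> x = c)" if \<phi>: "\<phi> \<in> set \<phi>s" for \<phi>
      proof (cases "?C \<phi>")
        case True
        then obtain d where d: "\<forall>x. eval_formula \<phi> x = d" ..
        with False \<phi> have "d \<noteq> (\<not> c)" by blast
        with d show ?thesis by simp
      qed (simp add: \<phi>s'_def \<phi>)
      with that(2,3) show ?thesis by (cases "\<phi>s' = []") auto
    qed (use that(1) in blast)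
    then show ?thesis
    proof cases
      case 1
      then have "eval_formula (G \<phi>s) x = (\<not> c)" for x using eval[of \<phi>s x] by auto
      then show ?thesis by blast
    next
      case 2
      then have "eval_formula (G \<phi>s) x = c" for x using eval[of \<phi>s x] by auto
      then show ?thesis by blast
    next
      case 3
      have "eval_formula (G (map p \<phi>s')) x = c \<longleftrightarrow> eval_formula (G \<phi>s) x = c" for x
      proof -
        have "(\<forall>\<phi>\<in>set \<phi>s'. eval_formula (p \<phi>) x = c) \<longleftrightarrow> (\<forall>\<phi>\<in>set \<phi>s'. eval_formula \<phi> x = c)"
          using p by blast
        also have "\<dots> \<longleftrightarrow> (\<forall>\<phi>\<in>set \<phi>s. eval_formula \<phi> x = c)"
          using 3(2) unfolding \<phi>s'_def set_filter by blast
        finally show ?thesis by (simp add: eval)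
      qed
      then have "\<forall>x. eval_formula (G (map p \<phi>s')) x = eval_formula (G \<phi>s) x" by blast
      moreover have "\<phi>s \<noteq> []" using 3(1) by (auto simp: \<phi>s'_def)
      then have "formula_size (G (map p \<phi>s')) \<le> gsize (G \<phi>s)"
        using size G by (auto simp: o_def)
      moreover have "formula_over n (G (map p \<phi>s'))" using p 3(1) G by auto
      ultimately show ?thesis by blast
    qed
  qed
  show ?thesis using assms
  proof (induction \<phi>)
    case (Lit b i)
    then show ?case by (intro disjI2 exI[of _ "Lit b i"]) auto
  next
    case (And \<phi>s)
    then show ?case by (intro gate[of And True]) (simp_all add: UN_subset_iff)
  next
    case (Or \<phi>s)
    then show ?case by (intro gate[of Or False]) (simp_all add: UN_subset_iff)
  qed
qed

lemma const_in_formula_class: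
  assumes "n \<ge> 1" "s \<ge> 1"
  shows "(\<lambda>x. c) \<in> formula_class n s"
proof -
  let ?\<phi> = "if c then Or [Lit True 0, Lit False 0] else And [Lit True 0, Lit False 0]"
  have "formula_over n ?\<phi>" "formula_size ?\<phi> \<le> s" "\<forall>x. eval_formula ?\<phi> x = c"
    using assms by auto
  then show ?thesis unfolding formula_class_def by blast
qed

text \<open>\<open>gsize\<close> counts constants as free, while in the class a constant costs a
  gate. That gate is paid for only if the whole formula is constant, since
  \<open>prune_constants\<close> removes all other constants.\<close>

lemma eval_in_formula_class:
  assumes "n \<ge> 1" "s \<ge> 1" "fvars \<phi> \<subseteq> {..<n}" "gsize \<phi> \<le> s"
  shows "eval_formula \<phi> \<in> formula_class n s"
  using prune_constants[OF assms(3)]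
proof
  assume "\<exists>c. \<forall>x. eval_formula \<phi> x = c"
  then obtain c where "eval_formula \<phi> = (\<lambda>x. c)" by auto
  then show ?thesis using const_in_formula_class assms by simp
next
  assume "\<exists>\<psi>. formula_over n \<psi> \<and> formula_size \<psi> \<le> gsize \<phi> \<and> (\<forall>x. eval_formula \<psi> x = eval_formula \<phi> x)"
  then obtain \<psi> where "formula_over n \<psi>" "formula_size \<psi> \<le> gsize \<phi>"
    "\<forall>x. eval_formula \<psi> x = eval_formula \<phi> x" by blast
  then show ?thesis using assms(4) unfolding formula_class_def
    by (intro CollectI exI[of _ \<psi>]) simp
qed

section \<open>Replacing wide gates by constants\<close>

fun is_lit :: "formula \<Rightarrow> bool" where
  "is_lit (Lit b i) = True"
| "is_lit _ = False"

definition lit_vars :: "formula list \<Rightarrow> nat set" where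
  "lit_vars \<phi>s = {i. \<exists>b. Lit b i \<in> set \<phi>s}"

text \<open>A conjunction with literals of many variables is almost always false, hence
  \<open>Or []\<close>; dually for disjunctions. Repeated literals are removed because
  \<open>formula_size\<close> does not bound the number of literal children; a gate that is kept
  then has at most 2 * L of them.\<close>

fun narrow :: "nat \<Rightarrow> formula \<Rightarrow> formula" where
  "narrow L (Lit b i) = Lit b i"
| "narrow L (And \<phi>s) = (if card (lit_vars \<phi>s) > L then Or []
     else And (remdups (filter is_lit \<phi>s) @ map (narrow L) (filter (\<lambda>\<phi>. \<not> is_lit \<phi>) \<phi>s)))"
| "narrow L (Or \<phi>s) = (if card (lit_vars \<phi>s) > L then And []
     else Or (remdups (filter is_lit \<phi>s) @ map (narrow L) (filter (\<lambda>\<phi>. \<not> is_lit \<phi>) \<phi>s)))"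

lemma is_lit_iff: "is_lit \<phi> \<longleftrightarrow> (\<exists>b i. \<phi> = Lit b i)"
  by (cases \<phi>) auto

lemma lit_vars_subset: "lit_vars \<phi>s \<subseteq> (\<Union>\<phi>\<in>set \<phi>s. fvars \<phi>)"
proof
  fix i assume "i \<in> lit_vars \<phi>s"
  then obtain b where "Lit b i \<in> set \<phi>s" by (auto simp: lit_vars_def)
  then show "i \<in> (\<Union>\<phi>\<in>set \<phi>s. fvars \<phi>)" by (intro UN_I[of "Lit b i"]) simp_all
qed

lemma finite_lit_vars: "finite (lit_vars \<phi>s)"
  by (rule finite_subset[OF lit_vars_subset]) simp

lemma length_remdups_lits: "length (remdups (filter is_lit \<phi>s)) \<le> 2 * card (lit_vars \<phi>s)"
proof -
  have "set (filter is_lit \<phi>s) \<subseteq> (\<lambda>(b, i). Lit b i) ` (UNIV \<times> lit_vars \<phi>s)"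
    by (auto simp: lit_vars_def is_lit_iff image_iff)
  then have "card (set (filter is_lit \<phi>s)) \<le> card ((UNIV :: bool set) \<times> lit_vars \<phi>s)"
    by (rule surj_card_le[rotated]) (simp add: finite_lit_vars)
  then show ?thesis
    by (simp add: length_remdups_card_conv card_cartesian_product)
qed

lemma nodes_is_lit: "(\<Sum>\<phi>\<leftarrow>remdups (filter is_lit \<phi>s). nodes \<phi>) = length (remdups (filter is_lit \<phi>s))"
proof -
  have "(\<Sum>\<phi>\<leftarrow>remdups (filter is_lit \<phi>s). nodes \<phi>) = (\<Sum>\<phi>\<leftarrow>remdups (filter is_lit \<phi>s). 1)"
    by (rule sum_list_cong) (auto simp: is_lit_iff)
  then show ?thesis by (simp add: sum_list_triv)
qed

lemma gsize_is_lit: "(\<Sum>\<phi>\<leftarrow>remdups (filter is_lit \<phi>s). gsize \<phi>) = 0"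
  by (auto simp: is_lit_iff)

text \<open>Each gate pays for itself and its at most 2 * L literals; its other children are gates
  and pay for themselves. The extra term is for a formula that is a single literal.\<close>

lemma nodes_narrow:
  "nodes (narrow L \<phi>) \<le> (2 * L + 1) * formula_size \<phi> + of_bool (is_lit \<phi>)"
proof (induction \<phi>)
  case (And \<phi>s)
  have "(\<Sum>\<phi>\<leftarrow>filter (\<lambda>\<phi>. \<not> is_lit \<phi>) \<phi>s. nodes (narrow L \<phi>))
      \<le> (\<Sum>\<phi>\<leftarrow>filter (\<lambda>\<phi>. \<not> is_lit \<phi>) \<phi>s. (2 * L + 1) * formula_size \<phi>)"
    by (rule sum_list_mono) (use And in fastforce)
  also have "\<dots> \<le> (\<Sum>\<phi>\<leftarrow>\<phi>s. (2 * L + 1) * formula_size \<phi>)"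
    by (rule sum_list_filter_le_nat)
  also have "\<dots> = (2 * L + 1) * (\<Sum>\<phi>\<leftarrow>\<phi>s. formula_size \<phi>)"
    by (rule sum_list_const_mult)
  finally show ?case
    using length_remdups_lits[of \<phi>s] nodes_is_lit[of \<phi>s] by (simp add: o_def)
next
  case (Or \<phi>s)
  have "(\<Sum>\<phi>\<leftarrow>filter (\<lambda>\<phi>. \<not> is_lit \<phi>) \<phi>s. nodes (narrow L \<phi>))
      \<le> (\<Sum>\<phi>\<leftarrow>filter (\<lambda>\<phi>. \<not> is_lit \<phi>) \<phi>s. (2 * L + 1) * formula_size \<phi>)"
    by (rule sum_list_mono) (use Or in fastforce)
  also have "\<dots> \<le> (\<Sum>\<phi>\<leftarrow>\<phi>s. (2 * L + 1) * formula_size \<phi>)"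
    by (rule sum_list_filter_le_nat)
  also have "\<dots> = (2 * L + 1) * (\<Sum>\<phi>\<leftarrow>\<phi>s. formula_size \<phi>)"
    by (rule sum_list_const_mult)
  finally show ?case
    using length_remdups_lits[of \<phi>s] nodes_is_lit[of \<phi>s] by (simp add: o_def)
qed simp

lemma gsize_narrow: "gsize (narrow L \<phi>) \<le> formula_size \<phi>"
proof (induction \<phi>)
  case (And \<phi>s)
  have "(\<Sum>\<phi>\<leftarrow>filter (\<lambda>\<phi>. \<not> is_lit \<phi>) \<phi>s. gsize (narrow L \<phi>))
      \<le> (\<Sum>\<phi>\<leftarrow>filter (\<lambda>\<phi>. \<not> is_lit \<phi>) \<phi>s. formula_size \<phi>)"
    by (rule sum_list_mono) (use And in auto)
  also have "\<dots> \<le> (\<Sum>\<phi>\<leftarrow>\<phi>s. formula_size \<phi>)"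
    by (rule sum_list_filter_le_nat)
  finally show ?case by (simp add: o_def gsize_is_lit)
next
  case (Or \<phi>s)
  have "(\<Sum>\<phi>\<leftarrow>filter (\<lambda>\<phi>. \<not> is_lit \<phi>) \<phi>s. gsize (narrow L \<phi>))
      \<le> (\<Sum>\<phi>\<leftarrow>filter (\<lambda>\<phi>. \<not> is_lit \<phi>) \<phi>s. formula_size \<phi>)"
    by (rule sum_list_mono) (use Or in auto)
  also have "\<dots> \<le> (\<Sum>\<phi>\<leftarrow>\<phi>s. formula_size \<phi>)"
    by (rule sum_list_filter_le_nat)
  finally show ?case by (simp add: o_def gsize_is_lit)
qed simp

lemma fvars_narrow: "fvars (narrow L \<phi>) \<subseteq> fvars \<phi>"
  by (induction \<phi>) auto

text \<open>One literal is selected for each variable. The event prescribes the values of all these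
  variables and so lies in a subcube.\<close>

lemma Pr_wide_gate:
  assumes "L \<le> card (lit_vars \<phi>s)" "lit_vars \<phi>s \<subseteq> {..<n}"
  shows "Pr (unif n) (\<lambda>x. \<forall>\<phi>\<in>set \<phi>s. eval_formula \<phi> x = c) \<le> (1 / 2) ^ L"
proof -
  define b where "b i = (SOME b. Lit b i \<in> set \<phi>s)" for i
  have b: "Lit (b i) i \<in> set \<phi>s" if "i \<in> lit_vars \<phi>s" for i
    using that unfolding b_def lit_vars_def by (auto intro: someI_ex)
  have "Pr (unif n) (\<lambda>x. \<forall>\<phi>\<in>set \<phi>s. eval_formula \<phi> x = c)
      \<le> Pr (unif n) (\<lambda>x. \<forall>i\<in>lit_vars \<phi>s. x ! i = (b i = c))"
  proof (intro Pr_mono ballI)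
    fix x i assume "\<forall>\<phi>\<in>set \<phi>s. eval_formula \<phi> x = c" "i \<in> lit_vars \<phi>s"
    then have "eval_formula (Lit (b i) i) x = c" using b by blast
    then show "x ! i = (b i = c)" by (auto split: if_splits)
  qed
  also have "\<dots> = (1 / 2) ^ card (lit_vars \<phi>s)"
    by (rule Pr_subcube) (use assms finite_lit_vars in auto)
  also have "\<dots> \<le> (1 / 2) ^ L" using assms by (intro power_decreasing) auto
  finally show ?thesis .
qed

lemma narrow_is_lit: "is_lit \<phi> \<Longrightarrow> narrow L \<phi> = \<phi>"
  by (cases \<phi>) auto

lemma narrow_image:
  "{\<phi> \<in> A. is_lit \<phi>} \<union> narrow L ` {\<phi> \<in> A. \<not> is_lit \<phi>} = narrow L ` A"
proof -
  have "narrow L ` A = narrow L ` {\<phi> \<in> A. is_lit \<phi>} \<union> narrow L ` {\<phi> \<in> A. \<not> is_lit \<phi>}"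
    by blast
  also have "narrow L ` {\<phi> \<in> A. is_lit \<phi>} = {\<phi> \<in> A. is_lit \<phi>}"
    by (simp add: narrow_is_lit)
  finally show ?thesis ..
qed

lemma eval_narrow_And:
  "card (lit_vars \<phi>s) \<le> L \<Longrightarrow>
    eval_formula (narrow L (And \<phi>s)) x \<longleftrightarrow> (\<forall>\<phi>\<in>set \<phi>s. eval_formula (narrow L \<phi>) x)"
  by (simp add: narrow_image)

lemma eval_narrow_Or:
  "card (lit_vars \<phi>s) \<le> L \<Longrightarrow>
    eval_formula (narrow L (Or \<phi>s)) x \<longleftrightarrow> (\<exists>\<phi>\<in>set \<phi>s. eval_formula (narrow L \<phi>) x)"
  by (simp add: narrow_image)

lemma dist_narrow:
  assumes "fvars \<phi> \<subseteq> {..<n}"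
  shows "Pr (unif n) (\<lambda>x. eval_formula \<phi> x \<noteq> eval_formula (narrow L \<phi>) x)
    \<le> real (formula_size \<phi>) * (1 / 2) ^ L"
proof -
  have sum: "(\<Sum>\<phi>\<leftarrow>\<phi>s. real (formula_size \<phi>) * c) = real (\<Sum>\<phi>\<leftarrow>\<phi>s. formula_size \<phi>) * c" for \<phi>s c
    by (induction \<phi>s) (simp_all add: distrib_right)
  have gate: "Pr (unif n) (\<lambda>x. eval_formula \<phi> x \<noteq> eval_formula (narrow L \<phi>) x)
      \<le> real (formula_size \<phi>) * (1 / 2) ^ L"
    if \<phi>: "\<phi> = And \<phi>s \<or> \<phi> = Or \<phi>s"
      and IH: "\<And>\<phi>. \<phi> \<in> set \<phi>s \<Longrightarrow>
        Pr (unif n) (\<lambda>x. eval_formula \<phi> x \<noteq> eval_formula (narrow L \<phi>) x) \<le> real (formula_size \<phi>) * (1 / 2) ^ L"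
      and vars: "fvars \<phi> \<subseteq> {..<n}"
    for \<phi> \<phi>s
  proof (cases "card (lit_vars \<phi>s) \<le> L")
    case True
    have "Pr (unif n) (\<lambda>x. eval_formula \<phi> x \<noteq> eval_formula (narrow L \<phi>) x)
       \<le> Pr (unif n) (\<lambda>x. \<exists>\<psi>\<in>set \<phi>s. eval_formula \<psi> x \<noteq> eval_formula (narrow L \<psi>) x)"
      by (rule Pr_mono) (use \<phi> eval_narrow_And[OF True] eval_narrow_Or[OF True] in auto)
    also have "\<dots> \<le> (\<Sum>\<phi>\<leftarrow>\<phi>s. real (formula_size \<phi>) * (1 / 2) ^ L)"
      by (rule Pr_UN_list) (rule IH)
    also have "\<dots> = real (\<Sum>\<phi>\<leftarrow>\<phi>s. formula_size \<phi>) * (1 / 2) ^ L" by (rule sum)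
    also have "\<dots> \<le> real (formula_size \<phi>) * (1 / 2) ^ L"
      using \<phi> by (intro mult_right_mono) auto
    finally show ?thesis .
  next
    case False
    have "fvars \<phi> = (\<Union>\<psi>\<in>set \<phi>s. fvars \<psi>)" using \<phi> by auto
    then have sub: "lit_vars \<phi>s \<subseteq> {..<n}" using vars lit_vars_subset[of \<phi>s] by blast
    \<comment> \<open>The new constant is the value that the wide gate almost always has, so a
      disagreement means that all children take the neutral value: true for \<open>And\<close>,
      false for \<open>Or\<close>.\<close>
    obtain c where c: "\<forall>x. (eval_formula \<phi> x \<noteq> eval_formula (narrow L \<phi>) x) =
        (\<forall>\<psi>\<in>set \<phi>s. eval_formula \<psi> x = c)"
    proof (rule that, intro allI)
      fix x show "(eval_formula \<phi> x \<noteq> eval_formula (narrow L \<phi>) x) =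
        (\<forall>\<psi>\<in>set \<phi>s. eval_formula \<psi> x = (\<phi> = And \<phi>s))"
        using \<phi> False by (elim disjE) simp_all
    qed
    have "Pr (unif n) (\<lambda>x. eval_formula \<phi> x \<noteq> eval_formula (narrow L \<phi>) x)
        = Pr (unif n) (\<lambda>x. \<forall>\<psi>\<in>set \<phi>s. eval_formula \<psi> x = c)"
      by (simp only: c)
    also have "\<dots> \<le> (1 / 2) ^ L"
      by (rule Pr_wide_gate) (use False sub in simp_all)
    also have "\<dots> \<le> real (formula_size \<phi>) * (1 / 2) ^ L" using \<phi> by auto
    finally show ?thesis .
  qed
  show ?thesis using assms
  proof (induction \<phi>)
    case (And \<phi>s)
    have "Pr (unif n) (\<lambda>x. eval_formula \<psi> x \<noteq> eval_formula (narrow L \<psi>) x)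
      \<le> real (formula_size \<psi>) * (1 / 2) ^ L" if "\<psi> \<in> set \<phi>s" for \<psi>
      by (rule And.IH[OF that]) (use And.prems that in auto)
    with gate[of "And \<phi>s" \<phi>s] And.prems show ?case by blast
  next
    case (Or \<phi>s)
    have "Pr (unif n) (\<lambda>x. eval_formula \<psi> x \<noteq> eval_formula (narrow L \<psi>) x)
      \<le> real (formula_size \<psi>) * (1 / 2) ^ L" if "\<psi> \<in> set \<phi>s" for \<psi>
      by (rule Or.IH[OF that]) (use Or.prems that in auto)
    with gate[of "Or \<phi>s" \<phi>s] Or.prems show ?case by blast
  qed simp
qed

(* A formula is encoded by the program of a stack machine that builds it: None pops a child and
   appends it to the gate below it. *)
fun exec :: "formula option \<Rightarrow> formula list \<Rightarrow> formula list" where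
  "exec (Some \<phi>) st = \<phi> # st"
| "exec None (\<psi> # And \<phi>s # st) = And (\<phi>s @ [\<psi>]) # st"
| "exec None (\<psi> # Or \<phi>s # st) = Or (\<phi>s @ [\<psi>]) # st"
| "exec None st = st"

fun compile :: "formula \<Rightarrow> formula option list" where
  "compile (Lit b i) = [Some (Lit b i)]"
| "compile (And \<phi>s) = Some (And []) # concat (map (\<lambda>\<phi>. compile \<phi> @ [None]) \<phi>s)"
| "compile (Or \<phi>s) = Some (Or []) # concat (map (\<lambda>\<phi>. compile \<phi> @ [None]) \<phi>s)"

lemma fold_exec_compile: "fold exec (compile \<phi>) st = \<phi> # st"
proof (induction \<phi> arbitrary: st)
  case (And \<phi>s)
  have "fold exec (concat (map (\<lambda>\<phi>. compile \<phi> @ [None]) \<psi>s)) (And \<chi>s # st) = And (\<chi>s @ \<psi>s) # st"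
    if "set \<psi>s \<subseteq> set \<phi>s" for \<psi>s \<chi>s
    using that by (induction \<psi>s arbitrary: \<chi>s) (auto simp: And)
  then show ?case by simp
next
  case (Or \<phi>s)
  have "fold exec (concat (map (\<lambda>\<phi>. compile \<phi> @ [None]) \<psi>s)) (Or \<chi>s # st) = Or (\<chi>s @ \<psi>s) # st"
    if "set \<psi>s \<subseteq> set \<phi>s" for \<psi>s \<chi>s
    using that by (induction \<psi>s arbitrary: \<chi>s) (auto simp: Or)
  then show ?case by simp
qed simp

text \<open>One push for each node and one \<open>None\<close> for each node except the
  root.\<close>

lemma length_compile: "Suc (length (compile \<phi>)) = 2 * nodes \<phi>"
proof -
  have *: "length (concat (map (\<lambda>\<phi>. compile \<phi> @ [None]) \<phi>s)) = 2 * (\<Sum>\<phi>\<leftarrow>\<phi>s. nodes \<phi>)"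
    if "\<And>\<phi>. \<phi> \<in> set \<phi>s \<Longrightarrow> Suc (length (compile \<phi>)) = 2 * nodes \<phi>" for \<phi>s
    using that by (induction \<phi>s) auto
  show ?thesis by (induction \<phi>) (auto simp: *)
qed

section \<open>Counting small formulas\<close>

definition tokens :: "nat \<Rightarrow> formula option set" where
  "tokens r = {None, Some (And []), Some (Or [])} \<union> (\<lambda>(b, i). Some (Lit b i)) ` (UNIV \<times> {..<r})"

lemma set_compile: "fvars \<phi> \<subseteq> {..<r} \<Longrightarrow> set (compile \<phi>) \<subseteq> tokens r"
  by (induction \<phi>) (auto simp: tokens_def image_iff)

lemma card_tokens: "card (tokens r) \<le> 2 * r + 3"
proof -
  have "card (tokens r) \<le> card {None, Some (And []), Some (Or [])} +
      card ((\<lambda>(b, i). Some (Lit b i)) ` ((UNIV :: bool set) \<times> {..<r}))"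
    unfolding tokens_def by (rule card_Un_le)
  also have "card ((\<lambda>(b, i). Some (Lit b i)) ` ((UNIV :: bool set) \<times> {..<r})) \<le> card ((UNIV :: bool set) \<times> {..<r})"
    by (rule card_image_le) simp
  finally show ?thesis by (simp add: card_cartesian_product card_insert_if split: if_splits)
qed

lemma sum_powers_le: "(\<Sum>i\<le>n. (a :: nat) ^ i) \<le> (a + 1) ^ n"
proof (induction n)
  case (Suc n)
  have "a ^ Suc n \<le> a * (a + 1) ^ n" by (simp add: power_mono del: mult_le_cancel1)
  with Suc have "(\<Sum>i\<le>Suc n. a ^ i) \<le> (a + 1) ^ n + a * (a + 1) ^ n"
    unfolding sum.atMost_Suc by (rule add_mono)
  then show ?case by simp
qed simp

definition small_formulas :: "nat \<Rightarrow> nat \<Rightarrow> formula set" where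
  "small_formulas r W = {\<phi>. fvars \<phi> \<subseteq> {..<r} \<and> nodes \<phi> \<le> W}"

lemma small_formulas_image:
  "small_formulas r W \<subseteq> (\<lambda>w. hd (fold exec w [])) ` {w. set w \<subseteq> tokens r \<and> length w \<le> 2 * W}"
proof
  fix \<phi> assume "\<phi> \<in> small_formulas r W"
  then have "compile \<phi> \<in> {w. set w \<subseteq> tokens r \<and> length w \<le> 2 * W}"
    using set_compile[of \<phi> r] length_compile[of \<phi>] by (auto simp: small_formulas_def)
  moreover have "\<phi> = hd (fold exec (compile \<phi>) [])" by (simp add: fold_exec_compile)
  ultimately show "\<phi> \<in> (\<lambda>w. hd (fold exec w [])) ` {w. set w \<subseteq> tokens r \<and> length w \<le> 2 * W}"
    by (rule rev_image_eqI)
qed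

lemma finite_small_formulas: "finite (small_formulas r W)"
  by (rule finite_subset[OF small_formulas_image])
    (auto intro!: finite_lists_length_le simp: tokens_def)

lemma card_small_formulas: "card (small_formulas r W) \<le> (2 * r + 4) ^ (2 * W)"
proof -
  have fin: "finite (tokens r)" by (simp add: tokens_def)
  have "card (small_formulas r W) \<le> card {w. set w \<subseteq> tokens r \<and> length w \<le> 2 * W}"
    by (rule surj_card_le[OF _ small_formulas_image]) (use fin in \<open>rule finite_lists_length_le\<close>)
  also have "\<dots> = (\<Sum>i\<le>2 * W. card (tokens r) ^ i)" using fin by (rule card_lists_length_le)
  also have "\<dots> \<le> (card (tokens r) + 1) ^ (2 * W)" by (rule sum_powers_le)
  also have "\<dots> \<le> (2 * r + 4) ^ (2 * W)" using card_tokens[of r] by (intro power_mono) auto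
  finally show ?thesis .
qed

section \<open>Random partitions and juntas\<close>

definition mix :: "nat \<Rightarrow> nat set \<Rightarrow> bool list \<Rightarrow> bool list \<Rightarrow> bool list" where
  "mix n J x w = map (\<lambda>i. if i \<in> J then x ! i else w ! i) [0..<n]"

lemma length_mix [simp]: "length (mix n J x w) = n"
  by (simp add: mix_def)

lemma mix_in_cube [simp]: "mix n J x w \<in> cube n"
  by (simp add: cube_def)

lemma nth_mix [simp]: "i < n \<Longrightarrow> mix n J x w ! i = (if i \<in> J then x ! i else w ! i)"
  by (simp add: mix_def)

lemma map_mix_unif: "map_pmf (\<lambda>(x, w). mix n J x w) (pair_pmf (unif n) (unif n)) = unif n"
proof (rule map_pmf_eq_unif_if_shift_invariant)
  fix v :: "bool list" assume v: "v \<in> cube n"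
  have "(case map_prod (\<lambda>x. xor_list x v) (\<lambda>x. xor_list x v) p of (x, w) \<Rightarrow> mix n J x w) =
      xor_list (case p of (x, w) \<Rightarrow> mix n J x w) v" if "p \<in> cube n \<times> cube n" for p
    using that v by (auto simp: cube_def intro!: nth_equalityI)
  then show "\<exists>\<sigma>. map_pmf \<sigma> (pair_pmf (unif n) (unif n)) = pair_pmf (unif n) (unif n) \<and>
      (\<forall>p\<in>set_pmf (pair_pmf (unif n) (unif n)).
        (case \<sigma> p of (x, w) \<Rightarrow> mix n J x w) = xor_list (case p of (x, w) \<Rightarrow> mix n J x w) v)"
    by (intro exI[of _ "map_prod (\<lambda>x. xor_list x v) (\<lambda>x. xor_list x v)"])
      (simp add: map_pair_unif_xor v)
qed auto

text \<open>The influence of the complement of J: the coordinates outside J are drawn anew. A small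
  value says that J almost determines f.\<close>

definition infl :: "nat \<Rightarrow> (bool list \<Rightarrow> bool) \<Rightarrow> nat set \<Rightarrow> real" where
  "infl n f J = Pr (pair_pmf (unif n) (unif n)) (\<lambda>(x, w). f x \<noteq> f (mix n J x w))"

lemma Pr_pair_assoc:
  "Pr (pair_pmf (pair_pmf M N) K) Q = Pr (pair_pmf M (pair_pmf N K)) (\<lambda>(x, y, z). Q ((x, y), z))"
  by (simp only: pair_pair_pmf Pr_map) (simp add: case_prod_unfold)

text \<open>Redraw the coordinates outside J and then those outside J'. In total, exactly those
  outside the intersection are fresh, and both steps start from a uniform point. For this the fresh
  string is itself written as a mixture of w and w'.\<close>

lemma infl_Int_le: "infl n f (J \<inter> J') \<le> infl n f J + infl n f J'"
proof -
  let ?U = "unif n" and ?m = "\<lambda>J (x, w). mix n J x w"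
  let ?T = "pair_pmf (pair_pmf ?U ?U) ?U"
  have "infl n f (J \<inter> J') =
      Pr (pair_pmf ?U (map_pmf (?m J') (pair_pmf ?U ?U))) (\<lambda>(x, w). f x \<noteq> f (mix n (J \<inter> J') x w))"
    by (simp only: infl_def map_mix_unif)
  also have "\<dots> = Pr ?T (\<lambda>((x, w), w'). f x \<noteq> f (mix n (J \<inter> J') x (mix n J' w w')))"
    by (simp only: pair_map_pmf2 Pr_map Pr_pair_assoc) (simp add: case_prod_unfold)
  also have "\<dots> \<le> Pr ?T (\<lambda>((x, w), w'). f x \<noteq> f (mix n J x w)) +
      Pr ?T (\<lambda>((x, w), w'). f (mix n J x w) \<noteq> f (mix n J' (mix n J x w) w'))"
  proof (rule Pr_le_disj[OF _ order_refl order_refl])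
    fix xww :: "(bool list \<times> bool list) \<times> bool list"
    obtain x w w' where xww: "xww = ((x, w), w')" by (metis surj_pair)
    have "mix n (J \<inter> J') x (mix n J' w w') = mix n J' (mix n J x w) w'"
      by (auto intro!: nth_equalityI)
    then show "(case xww of (xw, w') \<Rightarrow> (case xw of (x, w) \<Rightarrow> \<lambda>w'. f x \<noteq> f (mix n (J \<inter> J') x (mix n J' w w'))) w') \<Longrightarrow>
      (case xww of (xw, w') \<Rightarrow> (case xw of (x, w) \<Rightarrow> \<lambda>w'. f x \<noteq> f (mix n J x w)) w') \<or>
      (case xww of (xw, w') \<Rightarrow> (case xw of (x, w) \<Rightarrow> \<lambda>w'. f (mix n J x w) \<noteq> f (mix n J' (mix n J x w) w')) w')"
      by (auto simp: xww)
  qed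
  also have "Pr ?T (\<lambda>((x, w), w'). f x \<noteq> f (mix n J x w)) = infl n f J"
    using Pr_pair_conj[of "pair_pmf ?U ?U" ?U "\<lambda>(x, w). f x \<noteq> f (mix n J x w)" "\<lambda>_. True"]
    by (simp add: infl_def case_prod_unfold)
  also have "Pr ?T (\<lambda>((x, w), w'). f (mix n J x w) \<noteq> f (mix n J' (mix n J x w) w')) =
      Pr (pair_pmf (map_pmf (?m J) (pair_pmf ?U ?U)) ?U) (\<lambda>(x, w). f x \<noteq> f (mix n J' x w))"
    by (simp only: pair_map_pmf1 Pr_map) (simp add: case_prod_unfold)
  also have "\<dots> = infl n f J'"
    by (simp only: infl_def map_mix_unif)
  finally show ?thesis .
qed

definition depends_on :: "nat \<Rightarrow> nat set \<Rightarrow> (bool list \<Rightarrow> bool) \<Rightarrow> bool" where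
  "depends_on n V f \<longleftrightarrow> (\<forall>x\<in>cube n. \<forall>y\<in>cube n. (\<forall>i\<in>V. x ! i = y ! i) \<longrightarrow> f x = f y)"

definition junta :: "nat \<Rightarrow> nat \<Rightarrow> (bool list \<Rightarrow> bool) \<Rightarrow> bool" where
  "junta n k f \<longleftrightarrow> (\<exists>V\<subseteq>{..<n}. card V \<le> k \<and> depends_on n V f)"

text \<open>The junta is \<open>\<lambda>x. f (mix n J x w)\<close> for a fixed w that is no worse
  than the average.\<close>

lemma ex_near_junta:
  assumes "J \<subseteq> {..<n}"
  shows "\<exists>g. depends_on n J g \<and> Pr (unif n) (\<lambda>x. f x \<noteq> g x) \<le> infl n f J"
proof -
  obtain w where "Pr (unif n) (\<lambda>x. f x \<noteq> f (mix n J x w)) \<le> infl n f J"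
    using Pr_pair_ex_le[of "unif n" "unif n" "\<lambda>(w, x). f x \<noteq> f (mix n J x w)"]
    unfolding infl_def by (subst (asm) (2) Pr_pair_swap) auto
  moreover have "depends_on n J (\<lambda>x. f (mix n J x w))"
    unfolding depends_on_def
  proof (intro ballI impI)
    fix x y :: "bool list" assume "\<forall>i\<in>J. x ! i = y ! i"
    then have "mix n J x w = mix n J y w" by (intro nth_equalityI) auto
    then show "f (mix n J x w) = f (mix n J y w)" by simp
  qed
  ultimately show ?thesis by blast
qed

section \<open>Cross-intersecting families under a biased measure\<close>

definition overlap :: "bool list \<Rightarrow> bool list \<Rightarrow> nat" where
  "overlap x y = length (filter (\<lambda>(a, b). a \<and> b) (zip x y))"

lemma card_le_overlap:
  assumes "\<And>i. i \<in> J \<Longrightarrow> i < length x \<and> i < length y \<and> x ! i \<and> y ! i"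
  shows "card J \<le> overlap x y"
  unfolding overlap_def length_filter_conv_card
  by (rule card_mono) (use assms in auto)

lemma Pr_replicate_Suc_bool:
  fixes D :: "bool pmf"
  shows "Pr (replicate_pmf (Suc n) D) Q =
    pmf D True * Pr (replicate_pmf n D) (\<lambda>x. Q (True # x)) +
    (1 - pmf D True) * Pr (replicate_pmf n D) (\<lambda>x. Q (False # x))"
proof -
  have "Pr (replicate_pmf (Suc n) D) Q = Pr (pair_pmf D (replicate_pmf n D)) (\<lambda>(b, x). Q (b # x))"
    by (simp only: replicate_pmf_Suc_pair Pr_map) (simp add: case_prod_unfold)
  also have "\<dots> = (\<Sum>b\<in>UNIV. Pr (replicate_pmf n D) (\<lambda>x. Q (b # x)) * pmf D b)"
    unfolding Pr_pair prod.case by (rule integral_measure_pmf_real) auto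
  finally show ?thesis by (simp add: UNIV_bool pmf_False_conv_True mult.commute)
qed

text \<open>The four numbers are the measures of the sections of two families at True and False.
  Write \<beta> for the right-hand side. Bounding the four products by b, \<beta>, \<beta>, \<beta>
  gives only 2 * (1 - p) * \<beta>. Instead f0 * g0 is at most \<beta>^2 / (f1 * g1), because (f0 *
  g0) * (f1 * g1) = (f0 * g1) * (f1 * g0).\<close>

lemma cross_section_ineq:
  fixes p f1 f0 g1 g0 b :: real
  assumes p: "0 < p" "p \<le> 1 / 2" and nonneg: "0 \<le> f0" "0 \<le> g0" and mono: "f0 \<le> f1" "g0 \<le> g1"
    and b: "f1 * g1 \<le> b" "f0 * g1 \<le> (p / (1 - p))\<^sup>2 * b" "f1 * g0 \<le> (p / (1 - p))\<^sup>2 * b"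
  shows "(p * f1 + (1 - p) * f0) * (p * g1 + (1 - p) * g0) \<le> (p / (1 - p))\<^sup>2 * b"
proof -
  define u \<beta> where "u = f1 * g1" and "\<beta> = (p / (1 - p))\<^sup>2 * b"
  have u0: "0 \<le> u" using nonneg mono by (simp add: u_def)
  then have b0: "0 \<le> b" using b by (simp add: u_def)
  then have \<beta>0: "0 \<le> \<beta>" by (simp add: \<beta>_def)
  have le1: "p * f1 + (1 - p) * f0 \<le> f1" "p * g1 + (1 - p) * g0 \<le> g1"
    using p mono mult_left_mono[of f0 f1 "1 - p"] mult_left_mono[of g0 g1 "1 - p"]
    by (simp_all add: algebra_simps)
  show ?thesis
  proof (cases "u \<le> \<beta>")
    case True
    have "(p * f1 + (1 - p) * f0) * (p * g1 + (1 - p) * g0) \<le> f1 * g1"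
      by (intro mult_mono le1) (use p nonneg mono in auto)
    with True show ?thesis by (simp add: u_def \<beta>_def)
  next
    case False
    then have u: "u > 0" using \<beta>0 by simp
    have "(f0 * g0) * u = (f0 * g1) * (f1 * g0)" by (simp add: u_def)
    also have "\<dots> \<le> \<beta> * \<beta>"
      by (rule mult_mono) (use b nonneg mono \<beta>0 in \<open>auto simp: \<beta>_def\<close>)
    finally have fg0: "(f0 * g0) * u \<le> \<beta>\<^sup>2" by (simp add: power2_eq_square)
    have \<beta>b: "(1 - p)\<^sup>2 * \<beta> = p\<^sup>2 * b" using p by (simp add: \<beta>_def power_divide)
    have "(p * f1 + (1 - p) * f0) * (p * g1 + (1 - p) * g0) =
        p\<^sup>2 * u + p * (1 - p) * (f1 * g0 + f0 * g1) + (1 - p)\<^sup>2 * (f0 * g0)"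
      by (simp add: u_def power2_eq_square algebra_simps)
    also have "\<dots> \<le> p\<^sup>2 * u + p * (1 - p) * (\<beta> + \<beta>) + (1 - p)\<^sup>2 * (f0 * g0)"
      using p b nonneg by (intro add_mono mult_left_mono) (auto simp: \<beta>_def)
    finally have "(p * f1 + (1 - p) * f0) * (p * g1 + (1 - p) * g0) * u \<le>
        (p\<^sup>2 * u + p * (1 - p) * (\<beta> + \<beta>) + (1 - p)\<^sup>2 * (f0 * g0)) * u"
      using u by (intro mult_right_mono) auto
    also have "\<dots> = p\<^sup>2 * u * u + 2 * p * (1 - p) * \<beta> * u + (1 - p)\<^sup>2 * (f0 * g0 * u)"
      by (simp add: algebra_simps)
    also have "\<dots> \<le> p\<^sup>2 * u * u + 2 * p * (1 - p) * \<beta> * u + (1 - p)\<^sup>2 * \<beta>\<^sup>2"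
      using fg0 by (intro add_left_mono mult_left_mono) auto
    \<comment> \<open>Both factors of the subtracted product are nonnegative: u exceeds \<beta>, and
      (1 - p)^2 * \<beta> = p^2 * b is at least p^2 * u.\<close>
    also have "\<dots> = \<beta> * u - (u - \<beta>) * ((1 - p)\<^sup>2 * \<beta> - p\<^sup>2 * u)"
      by (simp add: power2_eq_square algebra_simps)
    also have "\<dots> \<le> \<beta> * u"
    proof -
      have "p\<^sup>2 * u \<le> p\<^sup>2 * b" using b by (intro mult_left_mono) (auto simp: u_def)
      then show ?thesis using False \<beta>b by simp
    qed
    finally show ?thesis using u by (simp add: \<beta>_def)
  qed
qed

(* Induction over the cube, splitting off one coordinate: the sections at True may overlap in one
   position less, and all other pairs of sections must overlap as much as the whole families. *)
lemma cross_intersecting_bound: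
  assumes p: "p = pmf D True" "0 < p" "p \<le> 1 / 2"
  assumes "\<And>x y. list_all2 (\<longrightarrow>) x y \<Longrightarrow> Q x \<Longrightarrow> Q y" "\<And>x y. list_all2 (\<longrightarrow>) x y \<Longrightarrow> R x \<Longrightarrow> R y"
    and "\<And>x y. length x = n \<Longrightarrow> length y = n \<Longrightarrow> Q x \<Longrightarrow> R y \<Longrightarrow> t \<le> overlap x y"
  shows "Pr (replicate_pmf n D) Q * Pr (replicate_pmf n D) R \<le> (p / (1 - p)) ^ (2 * t)"
  using assms(4-)
proof (induction n arbitrary: Q R t)
  case 0
  show ?case
  proof (cases t)
    case 0
    then show ?thesis by (simp add: mult_le_one)
  next
    case (Suc t')
    then have "\<not> Q [] \<or> \<not> R []" using "0.prems"(3)[of "[]" "[]"] by (auto simp: overlap_def)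
    then show ?thesis using p by (auto simp: indicator_def)
  qed
next
  case (Suc n)
  show ?case
  proof (cases t)
    case 0
    then show ?thesis by (simp add: mult_le_one)
  next
    case (Suc t')
    let ?P = "\<lambda>Q. Pr (replicate_pmf n D) Q"
    have sect: "?P (\<lambda>x. Q (a # x)) * ?P (\<lambda>x. R (a' # x)) \<le> (p / (1 - p)) ^ (2 * t'')"
      if t: "t = t'' + of_bool (a \<and> a')" for a a' t''
    proof (rule Suc.IH)
      show "t'' \<le> overlap x y" if "length x = n" "length y = n" "Q (a # x)" "R (a' # y)" for x y
        using Suc.prems(3)[of "a # x" "a' # y"] that t by (auto simp: overlap_def split: if_splits)
    qed (use Suc.prems in \<open>blast intro: list_all2_Cons[THEN iffD2]\<close>)+
    have refl: "list_all2 (\<longrightarrow>) x x" for x :: "bool list" by (simp add: list_all2_refl)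
    have pow: "(p / (1 - p)) ^ (2 * t) = (p / (1 - p))\<^sup>2 * (p / (1 - p)) ^ (2 * t')"
      by (simp add: \<open>t = Suc t'\<close> power2_eq_square)
    show ?thesis
      unfolding Pr_replicate_Suc_bool p(1)[symmetric] pow
    proof (rule cross_section_ineq)
      show "?P (\<lambda>x. Q (False # x)) \<le> ?P (\<lambda>x. Q (True # x))"
        by (rule Pr_mono) (rule Suc.prems(1), simp_all add: refl)
      show "?P (\<lambda>x. R (False # x)) \<le> ?P (\<lambda>x. R (True # x))"
        by (rule Pr_mono) (rule Suc.prems(2), simp_all add: refl)
      show "?P (\<lambda>x. Q (True # x)) * ?P (\<lambda>x. R (True # x)) \<le> (p / (1 - p)) ^ (2 * t')"
        by (rule sect) (simp add: \<open>t = Suc t'\<close>)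
      show "?P (\<lambda>x. Q (False # x)) * ?P (\<lambda>x. R (True # x)) \<le> (p / (1 - p))\<^sup>2 * (p / (1 - p)) ^ (2 * t')"
        unfolding pow[symmetric] by (rule sect) simp
      show "?P (\<lambda>x. Q (True # x)) * ?P (\<lambda>x. R (False # x)) \<le> (p / (1 - p))\<^sup>2 * (p / (1 - p)) ^ (2 * t')"
        unfolding pow[symmetric] by (rule sect) simp
    qed (use p in auto)
  qed
qed

(* The sets J with small infl n f J form an intersecting family. If it has a small member A, a
   random partition separates A, and the union of k parts meets A in at most k elements. Otherwise any
   two members have a large intersection, so that the family has a tiny biased measure. *)
lemma random_partition:
  assumes k: "1 \<le> k" "400 * k\<^sup>2 \<le> r"
    and far: "\<And>g. junta n k g \<Longrightarrow> \<delta> \<le> Pr (unif n) (\<lambda>x. f x \<noteq> g x)"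
  shows "Pr (replicate_pmf n (pmf_of_set {..<r}))
    (\<lambda>\<pi>. \<exists>S\<subseteq>{..<r}. card S \<le> k \<and> infl n f {i \<in> {..<n}. \<pi> ! i \<in> S} < \<delta> / 4) \<le> 1 / 100"
    (is "Pr ?M ?bad \<le> _")
proof -
  have "k * 1 \<le> k\<^sup>2" unfolding power2_eq_square using k by (intro mult_left_mono) auto
  then have rk: "2 * k \<le> r" "r > 0" using k by linarith+
  then have ne: "{..<r} \<noteq> {}" by auto
  have pmfM: "pmf (pmf_of_set {..<r}) c \<le> 1 / real r" for c
    using ne by (auto simp: indicator_def)
  have kr: "4 * real k ^ 2 / real r \<le> 1 / 100"
  proof -
    have "real (400 * k\<^sup>2) \<le> real r" using k by (simp only: of_nat_le_iff)
    then show ?thesis using rk by (simp add: field_simps)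
  qed
  \<comment> \<open>At most k variables with small \<open>infl\<close> would give a k-junta too
    close to f.\<close>
  have large: "k < card J" if J: "J \<subseteq> {..<n}" "infl n f J < \<delta>" for J
  proof (rule ccontr)
    assume "\<not> k < card J"
    moreover obtain g where g: "depends_on n J g" "Pr (unif n) (\<lambda>x. f x \<noteq> g x) \<le> infl n f J"
      using ex_near_junta[OF J(1)] by blast
    ultimately have "junta n k g" unfolding junta_def using J(1) by (intro exI[of _ J]) simp
    from far[OF this] g(2) J(2) show False by simp
  qed
  show ?thesis
  proof (cases "\<exists>A\<subseteq>{..<n}. infl n f A < \<delta> / 2 \<and> card A \<le> 2 * k")
    case True
    then obtain A where A: "A \<subseteq> {..<n}" "infl n f A < \<delta> / 2" "card A \<le> 2 * k" by blast
    have "Pr ?M ?bad \<le> Pr ?M (\<lambda>\<pi>. \<not> inj_on ((!) \<pi>) A)"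
    proof (rule Pr_mono, rule notI)
      fix \<pi> assume "?bad \<pi>" and inj: "inj_on ((!) \<pi>) A"
      then obtain S where S: "S \<subseteq> {..<r}" "card S \<le> k" "infl n f {i \<in> {..<n}. \<pi> ! i \<in> S} < \<delta> / 4"
        by blast
      let ?B = "A \<inter> {i \<in> {..<n}. \<pi> ! i \<in> S}"
      have "0 \<le> infl n f A" by (simp add: infl_def)
      \<comment> \<open>\<delta> / 2 from A and \<delta> / 4 from the union of parts stay below
        \<delta>, so the intersection has more than k elements. A partition injective on A allows
        only one element for each of the at most k parts.\<close>
      then have "infl n f ?B < \<delta>"
        using infl_Int_le[of n f A "{i \<in> {..<n}. \<pi> ! i \<in> S}"] A S by simp
      then have "k < card ?B" using A by (intro large) auto
      moreover have "card ?B \<le> card S"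
        by (rule card_inj_on_le[of "(!) \<pi>"])
          (use inj S finite_subset[OF S(1)] in \<open>auto intro: inj_on_subset\<close>)
      ultimately show False using S by simp
    qed
    also have "\<dots> \<le> 1 / 100"
    proof (rule Pr_not_inj_on[OF pmfM _ A(1)])
      have "real (card A) ^ 2 \<le> (2 * real k) ^ 2" using A by (intro power_mono) auto
      then have "real (card A) ^ 2 * (1 / real r) \<le> (2 * real k) ^ 2 * (1 / real r)"
        by (intro mult_right_mono) auto
      also have "\<dots> = 4 * real k ^ 2 / real r" by (simp add: power_mult_distrib)
      also note kr
      finally show "real (card A) ^ 2 * (1 / real r) \<le> 1 / 100" .
    qed auto
    finally show ?thesis .
  next
    case False
    \<comment> \<open>The up-set generated by the family, on characteristic vectors: the bound for
      cross-intersecting families needs monotonicity.\<close>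
    define Q where "Q b \<longleftrightarrow> (\<exists>J\<subseteq>{..<n}. infl n f J < \<delta> / 4 \<and> (\<forall>i\<in>J. i < length b \<and> b ! i))" for b
    let ?SS = "{S. S \<subseteq> {..<r} \<and> card S = k}"
    let ?p = "real k / real r"
    have Qmono: "Q y" if "list_all2 (\<longrightarrow>) x y" "Q x" for x y
    proof -
      obtain J where "J \<subseteq> {..<n}" "infl n f J < \<delta> / 4" "\<forall>i\<in>J. i < length x \<and> x ! i"
        using \<open>Q x\<close> unfolding Q_def by blast
      moreover from this(3) have "\<forall>i\<in>J. i < length y \<and> y ! i"
        using \<open>list_all2 (\<longrightarrow>) x y\<close> by (simp add: list_all2_conv_all_nth)
      ultimately show ?thesis unfolding Q_def by blast
    qed
    have Qcross: "2 * k \<le> overlap x y" if "length x = n" "length y = n" "Q x" "Q y" for x y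
    proof -
      obtain J where J: "J \<subseteq> {..<n}" "infl n f J < \<delta> / 4" "\<forall>i\<in>J. i < length x \<and> x ! i"
        using \<open>Q x\<close> unfolding Q_def by blast
      obtain J' where J': "J' \<subseteq> {..<n}" "infl n f J' < \<delta> / 4" "\<forall>i\<in>J'. i < length y \<and> y ! i"
        using \<open>Q y\<close> unfolding Q_def by blast
      have "infl n f (J \<inter> J') < \<delta> / 2" using infl_Int_le[of n f J J'] J J' by simp
      then have "2 * k < card (J \<inter> J')" using False J by (meson inf.coboundedI1 not_le)
      also have "\<dots> \<le> overlap x y" by (rule card_le_overlap) (use J J' in auto)
      finally show ?thesis by simp
    qed
    have p: "0 < ?p" "?p \<le> 1 / 2" using k rk by (auto simp: field_simps simp flip: of_nat_mult)
    have q: "1 / 2 \<le> 1 - ?p" "0 < 1 - ?p" "0 \<le> ?p / (1 - ?p)"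
    proof -
      show "1 / 2 \<le> 1 - ?p" using p by linarith
      show pos: "0 < 1 - ?p" using p by linarith
      show "0 \<le> ?p / (1 - ?p)" by (rule divide_nonneg_pos[OF less_imp_le[OF p(1)] pos])
    qed
    \<comment> \<open>Each variable falls into S independently with probability k / r, so the union
      of these parts is a random set under a biased product measure. The bound is applied to the
      family paired with itself, which is why a square root is taken.\<close>
    have Q: "Pr ?M (\<lambda>\<pi>. Q (map (\<lambda>c. c \<in> S) \<pi>)) \<le> (2 * real k / real r) ^ (2 * k)" if S: "S \<in> ?SS" for S
    proof -
      let ?D = "map_pmf (\<lambda>c. c \<in> S) (pmf_of_set {..<r})"
      have "pmf ?D True = Pr (pmf_of_set {..<r}) (\<lambda>c. c \<in> S)"
        by (simp only: pmf_eq_Pr Pr_map) simp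
      also have "\<dots> = ?p"
        using S ne by (simp add: measure_pmf_of_set Int_absorb1)
      finally have D: "?p = pmf ?D True" ..
      let ?c = "Pr (replicate_pmf n ?D) Q"
      have "?c * ?c \<le> (?p / (1 - ?p)) ^ (2 * (2 * k))"
        by (rule cross_intersecting_bound[OF D p]) (use Qmono Qcross in blast)+
      then have "?c\<^sup>2 \<le> ((?p / (1 - ?p)) ^ (2 * k))\<^sup>2"
        by (simp add: power2_eq_square power_mult[symmetric] mult.commute flip: power_add)
      then have "?c \<le> (?p / (1 - ?p)) ^ (2 * k)"
        by (rule power2_le_imp_le) (use q in auto)
      also have "\<dots> \<le> (?p / (1 / 2)) ^ (2 * k)"
        using q p by (intro power_mono divide_left_mono mult_pos_pos) auto
      finally show ?thesis
        by (simp only: map_replicate_pmf[symmetric] Pr_map) (simp add: mult.commute)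
    qed
    have "Pr ?M ?bad \<le> Pr ?M (\<lambda>\<pi>. \<exists>S\<in>?SS. Q (map (\<lambda>c. c \<in> S) \<pi>))"
    proof (rule Pr_mono)
      fix \<pi> assume \<pi>: "\<pi> \<in> set_pmf ?M" "?bad \<pi>"
      then obtain S where S: "S \<subseteq> {..<r}" "card S \<le> k" "infl n f {i \<in> {..<n}. \<pi> ! i \<in> S} < \<delta> / 4"
        by blast
      obtain S' where S': "S \<subseteq> S'" "S' \<subseteq> {..<r}" "card S' = k"
        using exists_subset_between[of S k "{..<r}"] S rk by auto
      have "Q (map (\<lambda>c. c \<in> S') \<pi>)"
        unfolding Q_def using S(3) S'(1) set_replicate_pmf_length[OF \<pi>(1)]
        by (intro exI[of _ "{i \<in> {..<n}. \<pi> ! i \<in> S}"]) auto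
      with S' show "\<exists>S\<in>?SS. Q (map (\<lambda>c. c \<in> S) \<pi>)" by blast
    qed
    also have "\<dots> \<le> 1 / 100"
    proof (rule Pr_UN_set[OF _ Q])
      have "card ?SS = r choose k" using n_subsets[of "{..<r}" k] by simp
      also have "\<dots> \<le> r ^ k" by (rule binomial_le_pow) (use rk in simp)
      finally have "real (card ?SS) \<le> real r ^ k" by (simp flip: of_nat_power)
      \<comment> \<open>Here intersections of size 2 * k, rather than k, beat the union bound: one
        factor 2 * k / r cancels each factor r, and the other makes the product small.\<close>
      then have "real (card ?SS) * (2 * real k / real r) ^ (2 * k)
          \<le> real r ^ k * ((2 * real k / real r)\<^sup>2) ^ k"
        by (simp add: mult_right_mono power_mult)
      also have "\<dots> = (4 * real k ^ 2 / real r) ^ k"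
        using rk by (simp add: power_mult_distrib[symmetric] power2_eq_square)
      also have "\<dots> \<le> (4 * real k ^ 2 / real r) ^ 1"
        using kr k by (intro power_decreasing) auto
      finally show "real (card ?SS) * (2 * real k / real r) ^ (2 * k) \<le> 1 / 100"
        using kr by simp
    qed auto
    finally show ?thesis .
  qed
qed

section \<open>Restrictions to a random partition\<close>

(* The random shift b makes a query uniform for every y. Merging the variables with a random partition p
   does not: variables of one block would always agree. *)
definition pull :: "nat \<Rightarrow> nat list \<Rightarrow> bool list \<Rightarrow> bool list \<Rightarrow> bool list" where
  "pull n p b y = map (\<lambda>i. y ! (p ! i) \<noteq> b ! i) [0..<n]"

lemma pull_in_cube [simp]: "pull n p b y \<in> cube n"
  by (simp add: pull_def cube_def)

lemma nth_pull [simp]: "i < n \<Longrightarrow> pull n p b y ! i \<longleftrightarrow> y ! (p ! i) \<noteq> b ! i"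
  by (simp add: pull_def)

lemma length_pull [simp]: "length (pull n p b y) = n"
  by (simp add: pull_def)

lemma map_pull_unif: "map_pmf (\<lambda>b. pull n p b y) (unif n) = unif n"
proof (rule map_pmf_eq_unif_if_shift_invariant)
  fix v :: "bool list" assume v: "v \<in> cube n"
  have "pull n p (xor_list b v) y = xor_list (pull n p b y) v" if "b \<in> cube n" for b
    using that v by (auto simp: cube_def intro!: nth_equalityI)
  then show "\<exists>\<sigma>. map_pmf \<sigma> (unif n) = unif n \<and>
      (\<forall>b\<in>set_pmf (unif n). pull n p (\<sigma> b) y = xor_list (pull n p b y) v)"
    by (intro exI[of _ "\<lambda>b. xor_list b v"]) (simp add: map_unif_xor v)
qed simp

lemma Pr_pull: "Pr (unif n) (\<lambda>b. Q (pull n p b y)) = Pr (unif n) Q"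
  by (subst (2) map_pull_unif[symmetric, of n p y]) (simp only: Pr_map)

text \<open>A point of the block cube that \<open>pull\<close> maps to a point agreeing with x on V.
  This is possible if the variables of V lie in different blocks; blocks without such a variable
  take their bits from z.\<close>

definition lift :: "nat \<Rightarrow> nat list \<Rightarrow> bool list \<Rightarrow> nat set \<Rightarrow> bool list \<Rightarrow> bool list \<Rightarrow> bool list" where
  "lift r p b V x z = map (\<lambda>l. if l \<in> (!) p ` V then x ! inv_into V ((!) p) l \<noteq> b ! inv_into V ((!) p) l
     else z ! l) [0..<r]"

text \<open>A translation of the result by v comes from adding v to z and flipping each variable of
  x by the bit of v at its block.\<close>

lemma map_lift_unif:
  assumes V: "V \<subseteq> {..<n}" "inj_on ((!) p) V"
  shows "map_pmf (\<lambda>(x, z). lift r p b V x z) (pair_pmf (unif n) (unif r)) = unif r"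
proof (rule map_pmf_eq_unif_if_shift_invariant)
  fix v :: "bool list" assume v: "v \<in> cube r"
  define a where "a = map (\<lambda>i. v ! (p ! i)) [0..<n]"
  have a: "a \<in> cube n" by (simp add: a_def cube_def)
  have inv: "inv_into V ((!) p) l < n" "p ! inv_into V ((!) p) l = l" if "l \<in> (!) p ` V" for l
    using inv_into_into[OF that] f_inv_into_f[OF that] V by auto
  have "(case map_prod (\<lambda>x. xor_list x a) (\<lambda>x. xor_list x v) q of (x, z) \<Rightarrow> lift r p b V x z) =
      xor_list (case q of (x, z) \<Rightarrow> lift r p b V x z) v" if "q \<in> cube n \<times> cube r" for q
    using that v a inv by (auto simp: cube_def lift_def a_def intro!: nth_equalityI)
  then show "\<exists>\<sigma>. map_pmf \<sigma> (pair_pmf (unif n) (unif r)) = pair_pmf (unif n) (unif r) \<and>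
      (\<forall>q\<in>set_pmf (pair_pmf (unif n) (unif r)).
        (case \<sigma> q of (x, z) \<Rightarrow> lift r p b V x z) = xor_list (case q of (x, z) \<Rightarrow> lift r p b V x z) v)"
    by (intro exI[of _ "map_prod (\<lambda>x. xor_list x a) (\<lambda>x. xor_list x v)"])
      (simp add: map_pair_unif_xor v a)
qed (auto simp: lift_def cube_def)

lemma depends_on_pull_lift:
  assumes "V \<subseteq> {..<n}" "inj_on ((!) p) V" "\<forall>i<n. p ! i < r"
    "depends_on n V g" "x \<in> cube n"
  shows "g (pull n p b (lift r p b V x z)) = g x"
proof -
  have "pull n p b (lift r p b V x z) ! i = x ! i" if "i \<in> V" for i
    using that assms(1-3) by (auto simp: lift_def inv_into_f_f)
  then show ?thesis
    using assms(4)[unfolded depends_on_def, rule_format, OF pull_in_cube assms(5)] by blast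
qed

(* The variables of psi that belong to blocks without a variable of g are fixed in the best way. *)
lemma transfer:
  assumes V: "V \<subseteq> {..<n}" "inj_on ((!) p) V" and p: "\<forall>i<n. p ! i < r"
    and g: "depends_on n V g" and \<psi>: "fvars \<psi> \<subseteq> {..<r}"
  obtains \<phi> where "fvars \<phi> \<subseteq> {i \<in> {..<n}. p ! i \<in> fvars \<psi>}" "gsize \<phi> = gsize \<psi>"
    "Pr (unif n) (\<lambda>x. g x \<noteq> eval_formula \<phi> x) \<le>
     Pr (unif r) (\<lambda>y. g (pull n p b y) \<noteq> eval_formula \<psi> y)"
proof -
  let ?l = "\<lambda>(x, z). lift r p b V x z"
  obtain z where z: "Pr (unif n) (\<lambda>x. g x \<noteq> eval_formula \<psi> (lift r p b V x z)) \<le>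
      Pr (pair_pmf (unif r) (unif n)) (\<lambda>(z, x). g x \<noteq> eval_formula \<psi> (lift r p b V x z))"
    using Pr_pair_ex_le[of "unif r" "unif n" "\<lambda>(z, x). g x \<noteq> eval_formula \<psi> (lift r p b V x z)"]
    by auto
  \<comment> \<open>\<open>lift\<close> in terms of literals: a block with a variable of V becomes
    that variable, negated according to b; any other block becomes a constant. Constants are empty
    gates, which \<open>gsize\<close> does not count.\<close>
  define \<sigma> where "\<sigma> c l = (if l \<in> (!) p ` V
      then Lit (c \<noteq> b ! inv_into V ((!) p) l) (inv_into V ((!) p) l)
      else if c = z ! l then And [] else Or [])" for c l
  have eval: "eval_formula (subst \<sigma> \<psi>) x = eval_formula \<psi> (lift r p b V x z)" for x
    by (rule eval_subst) (use \<psi> in \<open>auto simp: \<sigma>_def lift_def\<close>)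
  note z
  also have "Pr (pair_pmf (unif r) (unif n)) (\<lambda>(z, x). g x \<noteq> eval_formula \<psi> (lift r p b V x z)) =
      Pr (pair_pmf (unif n) (unif r)) (\<lambda>(x, z). g x \<noteq> eval_formula \<psi> (lift r p b V x z))"
    by (subst Pr_pair_swap) simp
  also have "\<dots> = Pr (pair_pmf (unif n) (unif r))
      (\<lambda>q. g (pull n p b (?l q)) \<noteq> eval_formula \<psi> (?l q))"
    by (rule Pr_cong) (auto simp: depends_on_pull_lift[OF V p g])
  also have "\<dots> = Pr (map_pmf ?l (pair_pmf (unif n) (unif r)))
      (\<lambda>y. g (pull n p b y) \<noteq> eval_formula \<psi> y)"
    by (simp only: Pr_map)
  finally have "Pr (unif n) (\<lambda>x. g x \<noteq> eval_formula (subst \<sigma> \<psi>) x) \<le>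
     Pr (unif r) (\<lambda>y. g (pull n p b y) \<noteq> eval_formula \<psi> y)"
    by (simp only: map_lift_unif[OF V] eval)
  moreover have "gsize (subst \<sigma> \<psi>) = gsize \<psi>"
    by (rule gsize_subst) (auto simp: \<sigma>_def)
  moreover have "fvars (subst \<sigma> \<psi>) \<subseteq> {i \<in> {..<n}. p ! i \<in> fvars \<psi>}"
  proof (rule fvars_subst, intro ballI allI)
    fix l c assume l: "l \<in> fvars \<psi>"
    show "fvars (\<sigma> c l) \<subseteq> {i \<in> {..<n}. p ! i \<in> fvars \<psi>}"
      using l inv_into_into[of l "(!) p" V] f_inv_into_f[of l "(!) p" V] V(1)
      by (auto simp: \<sigma>_def simp del: inv_into_f_f)
  qed
  ultimately show ?thesis by (intro that[of "subst \<sigma> \<psi>"])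
qed

text \<open>Redrawing the variables outside X does not change \<phi>, and the point is uniform
  before and after. So f has to differ from \<phi> at one of two uniform points.\<close>

lemma infl_le:
  assumes "fvars \<phi> \<subseteq> X" "fvars \<phi> \<subseteq> {..<n}"
  shows "infl n f X \<le> 2 * Pr (unif n) (\<lambda>x. f x \<noteq> eval_formula \<phi> x)"
proof -
  let ?U = "unif n" and ?d = "Pr (unif n) (\<lambda>x. f x \<noteq> eval_formula \<phi> x)"
  have "infl n f X \<le> ?d + ?d"
    unfolding infl_def
  proof (rule Pr_le_disj)
    let ?Q = "\<lambda>(x, w). f x \<noteq> eval_formula \<phi> x"
    let ?R = "\<lambda>(x, w). f (mix n X x w) \<noteq> eval_formula \<phi> (mix n X x w)"
    show "?Q xw \<or> ?R xw" if "case xw of (x, w) \<Rightarrow> f x \<noteq> f (mix n X x w)" for xw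
    proof -
      have "eval_formula \<phi> (mix n X x w) = eval_formula \<phi> x" for x w
      proof (rule eval_formula_cong, rule ballI)
        fix i assume "i \<in> fvars \<phi>"
        then have "i \<in> X" "i < n" using assms by blast+
        then show "mix n X x w ! i = x ! i" by simp
      qed
      then show ?thesis using that by (auto simp: case_prod_unfold)
    qed
    show "Pr (pair_pmf ?U ?U) ?Q \<le> ?d"
      using Pr_pair_conj[of ?U ?U "\<lambda>x. f x \<noteq> eval_formula \<phi> x" "\<lambda>_. True"]
      by (simp add: case_prod_unfold)
    have "Pr (pair_pmf ?U ?U) ?R =
      Pr (map_pmf (\<lambda>(x, w). mix n X x w) (pair_pmf ?U ?U)) (\<lambda>x. f x \<noteq> eval_formula \<phi> x)"
      by (simp only: Pr_map) (simp add: case_prod_unfold)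
    then show "Pr (pair_pmf ?U ?U) ?R \<le> ?d"
      by (simp only: map_mix_unif)
  qed
  then show ?thesis by simp
qed

text \<open>The node bound limits the number of hypotheses, for the union bound; the gate bound
  makes the formula obtained from a hypothesis by \<open>transfer\<close> a member of the
  class.\<close>

definition hyps :: "nat \<Rightarrow> nat \<Rightarrow> nat \<Rightarrow> formula set" where
  "hyps r W s = {\<psi> \<in> small_formulas r W. gsize \<psi> \<le> s}"

lemma finite_hyps: "finite (hyps r W s)"
  unfolding hyps_def by (rule finite_subset[OF _ finite_small_formulas[of r W]]) auto

lemma card_hyps: "card (hyps r W s) \<le> (2 * r + 4) ^ (2 * W)"
  by (rule order_trans[OF card_mono card_small_formulas])
    (auto simp: hyps_def finite_small_formulas)

text \<open>Literals are replaced by literals of their blocks, so nothing grows even if variables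
  collide.\<close>

lemma eval_pull_in_hyps:
  assumes "fvars \<phi> \<subseteq> {..<n}" "nodes \<phi> \<le> W" "gsize \<phi> \<le> s" "\<forall>i<n. p ! i < r"
  shows "\<exists>\<psi>\<in>hyps r W s. \<forall>y. eval_formula \<psi> y = eval_formula \<phi> (pull n p b y)"
proof -
  define \<sigma> where "\<sigma> c i = Lit (c \<noteq> b ! i) (p ! i)" for c i
  have "fvars (subst \<sigma> \<phi>) \<subseteq> {..<r}"
    by (rule fvars_subst) (use assms in \<open>auto simp: \<sigma>_def\<close>)
  moreover have "nodes (subst \<sigma> \<phi>) = nodes \<phi>" "gsize (subst \<sigma> \<phi>) = gsize \<phi>"
    by (rule nodes_subst gsize_subst; simp add: \<sigma>_def)+
  moreover have "eval_formula (subst \<sigma> \<phi>) y = eval_formula \<phi> (pull n p b y)" for y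
    by (rule eval_subst) (use assms in \<open>auto simp: \<sigma>_def\<close>)
  ultimately show ?thesis
    using assms by (intro bexI[of _ "subst \<sigma> \<phi>"]) (auto simp: hyps_def small_formulas_def)
qed

text \<open>Occam's razor: one \<alpha>-far hypothesis survives m samples with probability at most
  exp (- \<alpha> * m). The labels G will come from the narrowed formula in the completeness proof
  and from f itself in the soundness proof.\<close>

lemma Pr_consistent_but_far:
  assumes "finite H" "real (card H) \<le> N" "1 \<le> N" "ln (100 * N) \<le> \<alpha> * real m"
  shows "Pr (replicate_pmf m (unif r)) (\<lambda>ys. \<exists>\<psi>\<in>H.
    \<alpha> \<le> Pr (unif r) (\<lambda>y. G y \<noteq> eval_formula \<psi> y) \<and> (\<forall>y\<in>set ys. G y = eval_formula \<psi> y)) \<le> 1 / 100"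
proof (rule Pr_UN_set[OF assms(1)])
  fix \<psi>
  show "Pr (replicate_pmf m (unif r)) (\<lambda>ys. \<alpha> \<le> Pr (unif r) (\<lambda>y. G y \<noteq> eval_formula \<psi> y) \<and>
      (\<forall>y\<in>set ys. G y = eval_formula \<psi> y)) \<le> 1 / (100 * N)"
  proof (cases "\<alpha> \<le> Pr (unif r) (\<lambda>y. G y \<noteq> eval_formula \<psi> y)")
    case True
    have "Pr (replicate_pmf m (unif r)) (\<lambda>ys. \<forall>y\<in>set ys. G y = eval_formula \<psi> y) \<le> 1 / (100 * N)"
      by (rule Pr_replicate_all_le[OF True]) (use assms in auto)
    then show ?thesis using True by simp
  qed (use assms in simp)
qed (use assms in \<open>simp add: field_simps\<close>)

definition fits :: "formula set \<Rightarrow> bool list list \<Rightarrow> bool list \<Rightarrow> formula set" where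
  "fits H ys ls = {\<psi> \<in> H. map (eval_formula \<psi>) ys = ls}"

text \<open>\<open>SOME\<close> makes the choice of a hypothesis a function of F alone, so the pairs
  used for the check are independent of it.\<close>

definition kept :: "nat \<Rightarrow> nat list \<Rightarrow> formula set \<Rightarrow> nat set" where
  "kept n p F = {i \<in> {..<n}. p ! i \<in> fvars (SOME \<psi>. \<psi> \<in> F)}"

definition accepts :: "nat \<Rightarrow> formula set \<Rightarrow> (bool list \<Rightarrow> bool) \<Rightarrow>
    nat list \<times> (bool list \<times> bool list list) \<times> (bool list \<times> bool list) list \<Rightarrow> bool" where
  "accepts n H f = (\<lambda>(p, (b, ys), zs).
     (let F = fits H ys (map (\<lambda>y. f (pull n p b y)) ys) in
       F \<noteq> {} \<and> (\<forall>(x, w)\<in>set zs. f x = f (mix n (kept n p F) x w))))"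

text \<open>Nested in the order in which the errors are peeled off: the partition, then shift and
  labelled points, then the pairs.\<close>

definition samples :: "nat \<Rightarrow> nat \<Rightarrow> nat \<Rightarrow> nat \<Rightarrow>
    (nat list \<times> (bool list \<times> bool list list) \<times> (bool list \<times> bool list) list) pmf" where
  "samples n r m t = pair_pmf (replicate_pmf n (pmf_of_set {..<r}))
     (pair_pmf (pair_pmf (unif n) (replicate_pmf m (unif r)))
       (replicate_pmf t (pair_pmf (unif n) (unif n))))"

lemma in_fits: "\<psi> \<in> fits H ys (map (\<lambda>y. f (pull n p b y)) ys) \<longleftrightarrow>
    \<psi> \<in> H \<and> (\<forall>y\<in>set ys. f (pull n p b y) = eval_formula \<psi> y)"
  by (auto simp: fits_def)

section \<open>Error analysis of the acceptance event\<close>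

lemma partition_less:
  fixes r :: nat
  assumes "p \<in> set_pmf (replicate_pmf n (pmf_of_set {..<r}))" "r > 0" "i < n"
  shows "p ! i < r"
proof -
  have "p ! i \<in> set p" using set_replicate_pmf_length[OF assms(1)] assms(3) by simp
  then have "p ! i \<in> set_pmf (pmf_of_set {..<r})" by (rule set_replicate_pmf_elem[OF assms(1)])
  moreover have "{..<r} \<noteq> {}" using assms(2) by auto
  then have "set_pmf (pmf_of_set {..<r}) = {..<r}" by (rule set_pmf_of_set) simp
  ultimately show ?thesis by simp
qed

lemma Pr_collision_partition:
  fixes r :: nat
  assumes "400 * W\<^sup>2 \<le> r" "r > 0" "V \<subseteq> {..<n}" "card V \<le> W"
  shows "Pr (replicate_pmf n (pmf_of_set {..<r})) (\<lambda>p. \<not> inj_on ((!) p) V) \<le> 1 / 400"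
proof (rule Pr_not_inj_on[OF _ _ assms(3)])
  have "{..<r} \<noteq> {}" using assms by auto
  then show "pmf (pmf_of_set {..<r}) c \<le> 1 / real r" for c by (auto simp: indicator_def)
  have "400 * (card V)\<^sup>2 \<le> r" using power_mono[of "card V" W 2] assms by linarith
  then have "real (400 * (card V)\<^sup>2) \<le> real r" by (simp only: of_nat_le_iff)
  then show "real (card V) ^ 2 * (1 / real r) \<le> 1 / 400"
    using assms(2) by (simp add: field_simps)
qed simp

text \<open>The errors are: variables of \<phi> collide; some sample hits the difference of f and
  \<phi>; some consistent hypothesis is \<alpha>-far from the restriction of \<phi>; some pair shows
  a change. For the last, \<open>transfer\<close> turns the selected hypothesis into a formula near
  f on the kept variables.\<close>

lemma completeness:
  assumes r: "400 * W\<^sup>2 \<le> r" "r > 0"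
    and \<phi>: "fvars \<phi> \<subseteq> {..<n}" "nodes \<phi> \<le> W" "gsize \<phi> \<le> s"
    and \<eta>: "Pr (unif n) (\<lambda>x. f x \<noteq> eval_formula \<phi> x) \<le> \<eta>"
    and N: "real (card (hyps r W s)) \<le> N" "1 \<le> N" "ln (100 * N) \<le> \<alpha> * real m"
    and \<alpha>: "0 \<le> \<alpha>"
  shows "Pr (samples n r m t) (\<lambda>\<omega>. \<not> accepts n (hyps r W s) f \<omega>) \<le>
    1 / 400 + (real m * \<eta> + 1 / 100 + real t * (2 * (\<alpha> + \<eta>)))"
  unfolding samples_def
proof (rule Pr_pair_le)
  let ?H = "hyps r W s" and ?V = "fvars \<phi>"
  have \<eta>0: "0 \<le> \<eta>" by (rule order_trans[OF _ \<eta>]) simp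
  show "Pr (replicate_pmf n (pmf_of_set {..<r})) (\<lambda>p. \<not> inj_on ((!) p) ?V) \<le> 1 / 400"
    by (rule Pr_collision_partition[OF r \<phi>(1)]) (use card_fvars_le_nodes[of \<phi>] \<phi>(2) in simp)
  show "0 \<le> real m * \<eta> + 1 / 100 + real t * (2 * (\<alpha> + \<eta>))" using \<eta>0 \<alpha> by simp
  fix p assume "p \<in> set_pmf (replicate_pmf n (pmf_of_set {..<r}))" and "\<not> \<not> inj_on ((!) p) ?V"
  then have p: "\<forall>i<n. p ! i < r" and inj: "inj_on ((!) p) ?V"
    using partition_less r by auto
  have dep: "depends_on n ?V (eval_formula \<phi>)"
    unfolding depends_on_def using eval_formula_cong by blast
  \<comment> \<open>For each fixed y, the point \<open>pull n p b y\<close> is uniform over b, so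
    each sample costs \<eta>. ?E3 speaks of \<phi> instead of f, since for a given b the
    restrictions of the two need not be close.\<close>
  let ?E2 = "\<lambda>(b, ys). \<exists>y\<in>set ys. f (pull n p b y) \<noteq> eval_formula \<phi> (pull n p b y)"
  let ?E3 = "\<lambda>(b, ys). \<exists>\<psi>\<in>?H. \<alpha> \<le> Pr (unif r) (\<lambda>y. eval_formula \<phi> (pull n p b y) \<noteq> eval_formula \<psi> y) \<and>
      (\<forall>y\<in>set ys. eval_formula \<phi> (pull n p b y) = eval_formula \<psi> y)"
  let ?Y = "replicate_pmf m (unif r)"
  show "Pr (pair_pmf (pair_pmf (unif n) ?Y) (replicate_pmf t (pair_pmf (unif n) (unif n))))
      (\<lambda>\<omega>. \<not> accepts n ?H f (p, \<omega>)) \<le> real m * \<eta> + 1 / 100 + real t * (2 * (\<alpha> + \<eta>))"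
  proof (rule Pr_pair_le)
    show "Pr (pair_pmf (unif n) ?Y) (\<lambda>by. ?E2 by \<or> ?E3 by) \<le> real m * \<eta> + 1 / 100"
    proof (rule Pr_le_disj)
      show "Pr (pair_pmf (unif n) ?Y) ?E2 \<le> real m * \<eta>"
      proof (subst Pr_pair_swap, rule Pr_pair_le_uniform)
        fix ys assume "ys \<in> set_pmf ?Y"
        then have len: "length ys = m" by (rule set_replicate_pmf_length)
        have "Pr (unif n) (\<lambda>b. \<exists>y\<in>set ys. f (pull n p b y) \<noteq> eval_formula \<phi> (pull n p b y))
            \<le> (\<Sum>y\<leftarrow>ys. \<eta>)"
          by (rule Pr_UN_list) (simp only: Pr_pull[of n "\<lambda>x. f x \<noteq> eval_formula \<phi> x"] \<eta>)
        then show "Pr (unif n) (\<lambda>b. case (ys, b) of (ys, b) \<Rightarrow> ?E2 (b, ys)) \<le> real m * \<eta>"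
          by (simp add: sum_list_triv len)
      qed
      show "Pr (pair_pmf (unif n) ?Y) ?E3 \<le> 1 / 100"
      proof (rule Pr_pair_le_uniform)
        fix b
        show "Pr ?Y (\<lambda>ys. ?E3 (b, ys)) \<le> 1 / 100"
          using Pr_consistent_but_far[OF finite_hyps N] by simp
      qed
    qed simp
    show "0 \<le> real t * (2 * (\<alpha> + \<eta>))" using \<eta>0 \<alpha> by simp
    fix b_ys assume *: "b_ys \<in> set_pmf (pair_pmf (unif n) ?Y)" "\<not> (?E2 b_ys \<or> ?E3 b_ys)"
    obtain b ys where b_ys: "b_ys = (b, ys)" by (cases b_ys)
    have lab: "f (pull n p b y) = eval_formula \<phi> (pull n p b y)" if "y \<in> set ys" for y
      using * that by (simp add: b_ys)
    define F where "F = fits ?H ys (map (\<lambda>y. f (pull n p b y)) ys)"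
    define \<psi> where "\<psi> = (SOME \<psi>. \<psi> \<in> F)"
    obtain \<psi>' where \<psi>': "\<psi>' \<in> ?H" "\<forall>y. eval_formula \<psi>' y = eval_formula \<phi> (pull n p b y)"
      using eval_pull_in_hyps[OF \<phi> p, where b = b] by (elim bexE) (rule that)
    have "\<psi>' \<in> F" unfolding F_def in_fits using lab \<psi>' by simp
    then have F: "F \<noteq> {}" by blast
    then have \<psi>: "\<psi> \<in> F" unfolding \<psi>_def by (simp add: some_in_eq)
    then have \<psi>H: "\<psi> \<in> ?H" "\<forall>y\<in>set ys. eval_formula \<phi> (pull n p b y) = eval_formula \<psi> y"
      unfolding F_def in_fits using lab by auto
    then have near: "Pr (unif r) (\<lambda>y. eval_formula \<phi> (pull n p b y) \<noteq> eval_formula \<psi> y) \<le> \<alpha>"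
      using * by (auto simp: b_ys not_le)
    have "fvars \<psi> \<subseteq> {..<r}" using \<psi>H(1) by (simp add: hyps_def small_formulas_def)
    then obtain \<phi>' where \<phi>': "fvars \<phi>' \<subseteq> {i \<in> {..<n}. p ! i \<in> fvars \<psi>}"
      "gsize \<phi>' = gsize \<psi>"
      "Pr (unif n) (\<lambda>x. eval_formula \<phi> x \<noteq> eval_formula \<phi>' x) \<le>
       Pr (unif r) (\<lambda>y. eval_formula \<phi> (pull n p b y) \<noteq> eval_formula \<psi> y)"
      by (rule transfer[OF \<phi>(1) inj p dep, where b = b])
    have X: "kept n p F = {i \<in> {..<n}. p ! i \<in> fvars \<psi>}" by (simp add: kept_def \<psi>_def)
    have "Pr (unif n) (\<lambda>x. f x \<noteq> eval_formula \<phi>' x) \<le> \<eta> + \<alpha>"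
      by (rule Pr_le_disj[OF _ \<eta> order_trans[OF \<phi>'(3) near]]) auto
    moreover have "infl n f (kept n p F) \<le> 2 * Pr (unif n) (\<lambda>x. f x \<noteq> eval_formula \<phi>' x)"
      by (rule infl_le) (use \<phi>'(1) X in auto)
    ultimately have infl: "infl n f (kept n p F) \<le> 2 * (\<alpha> + \<eta>)" by simp
    have "(\<not> accepts n ?H f (p, b_ys, zs)) = (\<exists>xw\<in>set zs. case xw of (x, w) \<Rightarrow> f x \<noteq> f (mix n (kept n p F) x w))"
      for zs
      using F by (auto simp: accepts_def b_ys F_def)
    then show "Pr (replicate_pmf t (pair_pmf (unif n) (unif n))) (\<lambda>zs. \<not> accepts n ?H f (p, b_ys, zs))
        \<le> real t * (2 * (\<alpha> + \<eta>))"
      using Pr_replicate_ex_le[OF infl[unfolded infl_def] order_refl] by simp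
  qed
qed

text \<open>Whichever hypothesis is selected, it has at most W nodes and names at most W blocks. For
  a good partition each pair then exposes a change with probability at least \<delta> / 4.\<close>

lemma soundness_far_from_junta:
  assumes r: "400 * W\<^sup>2 \<le> r" "W \<ge> 1" and H: "H \<subseteq> small_formulas r W"
    and far: "\<And>g. junta n W g \<Longrightarrow> \<delta> \<le> Pr (unif n) (\<lambda>x. f x \<noteq> g x)"
    and t: "ln 100 \<le> \<delta> / 4 * real t"
  shows "Pr (samples n r m t) (accepts n H f) \<le> 1 / 100 + 1 / 100"
  unfolding samples_def
proof (rule Pr_pair_le)
  show "Pr (replicate_pmf n (pmf_of_set {..<r}))
      (\<lambda>p. \<exists>S\<subseteq>{..<r}. card S \<le> W \<and> infl n f {i \<in> {..<n}. p ! i \<in> S} < \<delta> / 4) \<le> 1 / 100"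
    by (rule random_partition[OF r(2,1)]) (rule far)
  fix p assume good: "\<not> (\<exists>S\<subseteq>{..<r}. card S \<le> W \<and> infl n f {i \<in> {..<n}. p ! i \<in> S} < \<delta> / 4)"
  show "Pr (pair_pmf (pair_pmf (unif n) (replicate_pmf m (unif r)))
      (replicate_pmf t (pair_pmf (unif n) (unif n)))) (\<lambda>\<omega>. accepts n H f (p, \<omega>)) \<le> 1 / 100"
  proof (rule Pr_pair_le_uniform)
    fix b_ys :: "bool list \<times> bool list list"
    obtain b ys where b_ys: "b_ys = (b, ys)" by (cases b_ys)
    define F where "F = fits H ys (map (\<lambda>y. f (pull n p b y)) ys)"
    let ?R = "\<lambda>(x, w). f x = f (mix n (kept n p F) x w)"
    have acc: "accepts n H f (p, b_ys, zs) \<longleftrightarrow> F \<noteq> {} \<and> (\<forall>xw\<in>set zs. ?R xw)" for zs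
      by (simp add: accepts_def b_ys F_def Let_def)
    show "Pr (replicate_pmf t (pair_pmf (unif n) (unif n))) (\<lambda>zs. accepts n H f (p, b_ys, zs)) \<le> 1 / 100"
    proof (cases "F = {}")
      case False
      define \<psi> where "\<psi> = (SOME \<psi>. \<psi> \<in> F)"
      have "\<psi> \<in> F" using False unfolding \<psi>_def by (simp add: some_in_eq)
      then have "\<psi> \<in> small_formulas r W" using H by (auto simp: F_def fits_def)
      then have "fvars \<psi> \<subseteq> {..<r}" "card (fvars \<psi>) \<le> W"
        using card_fvars_le_nodes[of \<psi>] by (auto simp: small_formulas_def)
      with good have "\<delta> / 4 \<le> infl n f {i \<in> {..<n}. p ! i \<in> fvars \<psi>}" by (meson not_le)
      then have "\<delta> / 4 \<le> Pr (pair_pmf (unif n) (unif n)) (\<lambda>xw. \<not> ?R xw)"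
        by (simp add: infl_def kept_def \<psi>_def case_prod_unfold)
      from Pr_replicate_all_le[OF this, of "1 / 100" t] t False show ?thesis
        by (simp add: acc)
    qed (simp add: acc)
  qed
qed auto

text \<open>Of the 6 * \<delta>, one \<delta> is the distance of f from g on the n-cube and five are
  allowed for their restrictions; Markov's inequality makes the latter fail with probability at most
  1 / 5. Otherwise every hypothesis is \<alpha>-far from the restriction of f, and it is unlikely
  that any fits.\<close>

lemma soundness_near_junta:
  assumes r: "400 * W\<^sup>2 \<le> r" "r > 0"
    and g: "junta n W g" "Pr (unif n) (\<lambda>x. f x \<noteq> g x) \<le> \<delta>" "\<delta> > 0"
    and far: "\<And>\<phi>. fvars \<phi> \<subseteq> {..<n} \<Longrightarrow> gsize \<phi> \<le> s \<Longrightarrow> \<epsilon> \<le> Pr (unif n) (\<lambda>x. f x \<noteq> eval_formula \<phi> x)"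
    and N: "real (card (hyps r W s)) \<le> N" "1 \<le> N" "ln (100 * N) \<le> \<alpha> * real m"
    and \<alpha>: "\<alpha> \<le> \<epsilon> - 6 * \<delta>"
  shows "Pr (samples n r m t) (accepts n (hyps r W s) f) \<le> 1 / 400 + (1 / 5 + 1 / 100)"
proof -
  let ?H = "hyps r W s" and ?Y = "replicate_pmf m (unif r)"
  obtain V where V: "V \<subseteq> {..<n}" "card V \<le> W" "depends_on n V g"
    using g(1) unfolding junta_def by blast
  let ?fit = "\<lambda>p (b, ys). fits ?H ys (map (\<lambda>y. f (pull n p b y)) ys) \<noteq> {}"
  show ?thesis
    unfolding samples_def
  proof (rule Pr_pair_le[OF Pr_collision_partition[OF r V(1,2)]])
    fix p assume "p \<in> set_pmf (replicate_pmf n (pmf_of_set {..<r}))" and "\<not> \<not> inj_on ((!) p) V"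
    then have p: "\<forall>i<n. p ! i < r" and inj: "inj_on ((!) p) V"
      using partition_less r by auto
    let ?B = "\<lambda>b. 5 * \<delta> \<le> Pr (unif r) (\<lambda>y. f (pull n p b y) \<noteq> g (pull n p b y))"
    have fit: "Pr (pair_pmf (unif n) ?Y) (?fit p) \<le> 1 / 5 + 1 / 100"
    proof (rule Pr_pair_le)
      have "Pr (pair_pmf (unif n) (unif r)) (\<lambda>(b, y). f (pull n p b y) \<noteq> g (pull n p b y)) \<le> \<delta>"
        by (subst Pr_pair_swap, rule Pr_pair_le_uniform)
          (simp only: prod.case Pr_pull[of n "\<lambda>x. f x \<noteq> g x"] g)
      then show "Pr (unif n) ?B \<le> 1 / 5"
        using Pr_pair_Markov[of "5 * \<delta>" "unif n" "unif r"
            "\<lambda>(b, y). f (pull n p b y) \<noteq> g (pull n p b y)" "1 / 5"] g(3) by simp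
      fix b assume b: "\<not> ?B b"
      have far': "\<alpha> \<le> Pr (unif r) (\<lambda>y. f (pull n p b y) \<noteq> eval_formula \<psi> y)" if "\<psi> \<in> ?H" for \<psi>
      proof -
        have \<psi>: "fvars \<psi> \<subseteq> {..<r}" "gsize \<psi> \<le> s"
          using that by (auto simp: hyps_def small_formulas_def)
        obtain \<phi> where \<phi>: "fvars \<phi> \<subseteq> {i \<in> {..<n}. p ! i \<in> fvars \<psi>}" "gsize \<phi> = gsize \<psi>"
          "Pr (unif n) (\<lambda>x. g x \<noteq> eval_formula \<phi> x) \<le>
           Pr (unif r) (\<lambda>y. g (pull n p b y) \<noteq> eval_formula \<psi> y)"
          by (rule transfer[OF V(1) inj p V(3) \<psi>(1), where b = b])
        have "\<epsilon> \<le> Pr (unif n) (\<lambda>x. f x \<noteq> eval_formula \<phi> x)"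
          by (rule far) (use \<phi> \<psi> in auto)
        also have "\<dots> \<le> \<delta> + Pr (unif r) (\<lambda>y. g (pull n p b y) \<noteq> eval_formula \<psi> y)"
          by (rule Pr_le_disj[OF _ g(2) \<phi>(3)]) auto
        also have "Pr (unif r) (\<lambda>y. g (pull n p b y) \<noteq> eval_formula \<psi> y) \<le>
          Pr (unif r) (\<lambda>y. f (pull n p b y) \<noteq> g (pull n p b y)) +
          Pr (unif r) (\<lambda>y. f (pull n p b y) \<noteq> eval_formula \<psi> y)"
          by (rule Pr_le_disj[OF _ order_refl order_refl]) auto
        finally show ?thesis using b \<alpha> by simp
      qed
      have "Pr ?Y (\<lambda>ys. ?fit p (b, ys)) \<le> Pr ?Y (\<lambda>ys. \<exists>\<psi>\<in>?H.
        \<alpha> \<le> Pr (unif r) (\<lambda>y. f (pull n p b y) \<noteq> eval_formula \<psi> y) \<and>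
        (\<forall>y\<in>set ys. f (pull n p b y) = eval_formula \<psi> y))"
      proof (rule Pr_mono)
        fix ys assume "?fit p (b, ys)"
        then obtain \<psi> where "\<psi> \<in> fits ?H ys (map (\<lambda>y. f (pull n p b y)) ys)" by auto
        then show "\<exists>\<psi>\<in>?H. \<alpha> \<le> Pr (unif r) (\<lambda>y. f (pull n p b y) \<noteq> eval_formula \<psi> y) \<and>
          (\<forall>y\<in>set ys. f (pull n p b y) = eval_formula \<psi> y)"
          unfolding in_fits using far' by blast
      qed
      also have "\<dots> \<le> 1 / 100" by (rule Pr_consistent_but_far[OF finite_hyps N])
      finally show "Pr ?Y (\<lambda>ys. ?fit p (b, ys)) \<le> 1 / 100" .
    qed simp
    have "Pr (pair_pmf (pair_pmf (unif n) ?Y) (replicate_pmf t (pair_pmf (unif n) (unif n))))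
      (\<lambda>\<omega>. accepts n ?H f (p, \<omega>)) \<le> (1 / 5 + 1 / 100) + 0"
    proof (rule Pr_pair_le[OF fit order_refl])
      fix b_ys assume "\<not> ?fit p b_ys"
      then have "\<not> accepts n ?H f (p, b_ys, zs)" for zs
        by (cases b_ys) (simp add: accepts_def)
      then show "Pr (replicate_pmf t (pair_pmf (unif n) (unif n))) (\<lambda>zs. accepts n ?H f (p, b_ys, zs)) \<le> 0"
        by simp
    qed
    then show "Pr (pair_pmf (pair_pmf (unif n) ?Y) (replicate_pmf t (pair_pmf (unif n) (unif n))))
      (\<lambda>\<omega>. accepts n ?H f (p, \<omega>)) \<le> 1 / 5 + 1 / 100" by simp
  qed simp
qed

section \<open>The tester\<close>

primrec draw_list :: "nat \<Rightarrow> nat \<Rightarrow> (bool list list \<Rightarrow> algorithm) \<Rightarrow> algorithm" where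
  "draw_list 0 m k = k []"
| "draw_list (Suc c) m k = Draw m (\<lambda>x. draw_list c m (\<lambda>xs. k (x # xs)))"

primrec draw_pairs :: "nat \<Rightarrow> nat \<Rightarrow> ((bool list \<times> bool list) list \<Rightarrow> algorithm) \<Rightarrow> algorithm" where
  "draw_pairs 0 m k = k []"
| "draw_pairs (Suc c) m k = Draw m (\<lambda>x. Draw m (\<lambda>w. draw_pairs c m (\<lambda>zs. k ((x, w) # zs))))"

primrec query_list :: "bool list list \<Rightarrow> (bool list \<Rightarrow> algorithm) \<Rightarrow> algorithm" where
  "query_list [] k = k []"
| "query_list (x # xs) k = Query x (\<lambda>b. query_list xs (\<lambda>bs. k (b # bs)))"

lemma run_draw_list:
  "run (draw_list c m k) f = bind_pmf (replicate_pmf c (unif m)) (\<lambda>xs. run (k xs) f)"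
  by (induction c arbitrary: k) (simp_all add: bind_assoc_pmf bind_return_pmf)

lemma run_draw_pairs:
  "run (draw_pairs c m k) f =
    bind_pmf (replicate_pmf c (pair_pmf (unif m) (unif m))) (\<lambda>zs. run (k zs) f)"
  by (induction c arbitrary: k) (simp_all add: bind_assoc_pmf bind_return_pmf pair_pmf_def)

lemma run_query_list: "run (query_list xs k) f = run (k (map f xs)) f"
  by (induction xs arbitrary: k) simp_all

lemma queries_draw_list:
  "(\<And>xs. length xs = c \<Longrightarrow> queries_at_most n (k xs) q) \<Longrightarrow> queries_at_most n (draw_list c m k) q"
  by (induction c arbitrary: k) (auto intro: queries_at_most.intros)

lemma queries_draw_pairs:
  "(\<And>zs. length zs = c \<Longrightarrow> set zs \<subseteq> cube m \<times> cube m \<Longrightarrow> queries_at_most n (k zs) q) \<Longrightarrow>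
    queries_at_most n (draw_pairs c m k) q"
  by (induction c arbitrary: k) (auto intro!: queries_at_most.intros)

lemma queries_query_list:
  "set xs \<subseteq> cube n \<Longrightarrow> (\<And>bs. queries_at_most n (k bs) q) \<Longrightarrow>
    queries_at_most n (query_list xs k) (length xs + q)"
  by (induction xs arbitrary: k) (auto intro!: queries_at_most.intros)

text \<open>Only bit strings can be drawn, so the number of blocks is a power of two and a string of
  length L selects a block.\<close>

definition block_index :: "nat \<Rightarrow> bool list \<Rightarrow> nat" where
  "block_index L = (SOME h. bij_betw h (cube L) {..<2 ^ L})"

lemma map_block_index: "map_pmf (block_index L) (unif L) = pmf_of_set {..<2 ^ L}"
proof (rule map_pmf_of_set_bij_betw)
  have "\<exists>h. bij_betw h (cube L) {..<2 ^ L :: nat}"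
    by (rule finite_same_card_bij) (simp_all add: card_cube)
  then show "bij_betw (block_index L) (cube L) {..<2 ^ L}"
    unfolding block_index_def by (rule someI_ex)
qed simp_all

text \<open>The second batch lists the points x and then their mixtures, so comparing the two halves
  of the answers compares f on each pair. Adaptivity lies only in the dependence of this batch on
  the labels.\<close>

definition tester :: "nat \<Rightarrow> nat \<Rightarrow> nat \<Rightarrow> nat \<Rightarrow> formula set \<Rightarrow> algorithm" where
  "tester n L m t H = draw_list n L (\<lambda>ps. Draw n (\<lambda>b. draw_list m (2 ^ L) (\<lambda>ys. draw_pairs t n (\<lambda>zs.
     let p = map (block_index L) ps in query_list (map (pull n p b) ys) (\<lambda>ls.
       let F = fits H ys ls in
       if F = {} then Answer False
       else query_list (map fst zs @ map (\<lambda>(x, w). mix n (kept n p F) x w) zs)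
         (\<lambda>as. Answer (take t as = drop t as)))))))"

lemma run_tester: "run (tester n L m t H) f = map_pmf (accepts n H f) (samples n (2 ^ L) m t)"
proof -
  let ?Z = "replicate_pmf t (pair_pmf (unif n) (unif n))"
  let ?Y = "replicate_pmf m (unif (2 ^ L))"
  have "run (tester n L m t H) f = bind_pmf (replicate_pmf n (unif L)) (\<lambda>ps. bind_pmf (unif n) (\<lambda>b.
      bind_pmf ?Y (\<lambda>ys. bind_pmf ?Z (\<lambda>zs.
        return_pmf (accepts n H f (map (block_index L) ps, (b, ys), zs))))))"
    unfolding tester_def run_draw_list run_draw_pairs run.simps Let_def run_query_list
  proof (intro bind_pmf_cong refl)
    fix ps b ys zs assume "zs \<in> set_pmf ?Z"
    then have len: "length zs = t" by (rule set_replicate_pmf_length)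
    let ?p = "map (block_index L) ps"
    let ?F = "fits H ys (map f (map (pull n ?p b) ys))"
    have "(take t (map f (map fst zs @ map (\<lambda>(x, w). mix n (kept n ?p ?F) x w) zs)) =
        drop t (map f (map fst zs @ map (\<lambda>(x, w). mix n (kept n ?p ?F) x w) zs))) =
      (\<forall>(x, w)\<in>set zs. f x = f (mix n (kept n ?p ?F) x w))"
      by (simp add: len case_prod_unfold)
    then show "run (if ?F = {} then Answer False
         else query_list (map fst zs @ map (\<lambda>(x, w). mix n (kept n ?p ?F) x w) zs)
           (\<lambda>as. Answer (take t as = drop t as))) f =
      return_pmf (accepts n H f (?p, (b, ys), zs))"
      by (simp add: run_query_list accepts_def Let_def o_def)
  qed
  also have "\<dots> = map_pmf (accepts n H f) (samples n (2 ^ L) m t)"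
    unfolding samples_def map_block_index[symmetric] map_replicate_pmf[symmetric]
    by (simp add: pair_pmf_def map_bind_pmf bind_map_pmf bind_assoc_pmf bind_return_pmf)
  finally show ?thesis .
qed

lemma queries_tester: "queries_at_most n (tester n L m t H) (m + 2 * t)"
  unfolding tester_def Let_def
proof (intro queries_draw_list queries_at_most.intros(3) queries_draw_pairs)
  fix ps b ys zs
  assume ys: "length (ys :: bool list list) = m"
    and zs: "length zs = t" "set zs \<subseteq> cube n \<times> cube n"
  let ?p = "map (block_index L) ps"
  have "queries_at_most n (query_list (map (pull n ?p b) ys) (\<lambda>ls.
     if fits H ys ls = {} then Answer False
     else query_list (map fst zs @ map (\<lambda>(x, w). mix n (kept n ?p (fits H ys ls)) x w) zs)
         (\<lambda>as. Answer (take t as = drop t as)))) (length (map (pull n ?p b) ys) + 2 * t)"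
  proof (rule queries_query_list)
    fix ls
    let ?xs = "map fst zs @ map (\<lambda>(x, w). mix n (kept n ?p (fits H ys ls)) x w) zs"
    have "queries_at_most n (query_list ?xs (\<lambda>as. Answer (take t as = drop t as))) (length ?xs + 0)"
      by (rule queries_query_list) (use zs in \<open>auto intro: queries_at_most.intros\<close>)
    then show "queries_at_most n (if fits H ys ls = {} then Answer False
      else query_list ?xs (\<lambda>as. Answer (take t as = drop t as))) (2 * t)"
      by (simp add: zs mult_2 queries_at_most.intros)
  qed auto
  then show "queries_at_most n (query_list (map (pull n ?p b) ys) (\<lambda>ls.
     if fits H ys ls = {} then Answer False
     else query_list (map fst zs @ map (\<lambda>(x, w). mix n (kept n ?p (fits H ys ls)) x w) zs)
         (\<lambda>as. Answer (take t as = drop t as)))) (m + 2 * t)"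
    by (simp add: ys)
qed

lemma pmf_run_tester_True:
  "pmf (run (tester n L m t H) f) True = Pr (samples n (2 ^ L) m t) (accepts n H f)"
  by (simp only: run_tester pmf_eq_Pr Pr_map eq_True)

(* The same L bounds the number of literal variables of a gate and gives r = 2 ^ L blocks. The
   constants keep the total error below 1/3. *)
definition gate_width :: "nat \<Rightarrow> real \<Rightarrow> nat" where
  "gate_width s \<epsilon> = nat \<lceil>4 * ln (real s / \<epsilon>)\<rceil> + 60"

definition node_bound :: "nat \<Rightarrow> real \<Rightarrow> nat" where
  "node_bound s \<epsilon> = (2 * gate_width s \<epsilon> + 1) * s + 1"

text \<open>Chosen so that (\<epsilon> / 20000) * m reaches ln (100 * N): 7 bounds ln 100, and gate
  width plus 3 bounds the logarithm of the base in \<open>card_hyps\<close>.\<close>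

definition num_samples :: "nat \<Rightarrow> real \<Rightarrow> nat" where
  "num_samples s \<epsilon> = nat \<lceil>(7 + 2 * real (node_bound s \<epsilon>) * real (gate_width s \<epsilon> + 3)) * 20000 / \<epsilon>\<rceil>"

text \<open>For f that is \<epsilon> / 12-far from juntas, a pair exposes a change with probability
  at least \<epsilon> / 48, and 480 / 48 = 10 exceeds ln 100.\<close>

definition num_pairs :: "real \<Rightarrow> nat" where
  "num_pairs \<epsilon> = nat \<lceil>480 / \<epsilon>\<rceil>"

section \<open>Numerical bounds on the parameters\<close>

lemma nat_ceiling_bounds: "0 \<le> x \<Longrightarrow> x \<le> real (nat \<lceil>x\<rceil>) \<and> real (nat \<lceil>x\<rceil>) \<le> x + 1"
  by linarith

lemma ln_100_le: "ln 100 \<le> (7 :: real)"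
proof -
  have "ln (64 :: real) = 6 * ln 2" using ln_realpow[of "2 :: real" 6] by simp
  moreover have "ln (100 :: real) = ln 64 + ln (25 / 16)" using ln_mult_pos[of "64 :: real" "25 / 16"] by simp
  moreover have "ln (25 / 16 :: real) \<le> 25 / 16 - 1" by (rule ln_le_minus_one) simp
  ultimately show ?thesis using ln_2_less_1 by simp
qed

text \<open>The last inequality serves twice: it gives r \<ge> 400 * W^2 blocks, and it makes the
  number of queries times s / 2^L at most 1 / 4.\<close>

lemma gate_width_bounds:
  assumes s: "1 \<le> s" and \<epsilon>: "0 < \<epsilon>" "\<epsilon> \<le> 1"
  defines "T \<equiv> real s / \<epsilon>" and "L \<equiv> gate_width s \<epsilon>"
  shows "1 \<le> T" "real s \<le> T" "real L \<le> 4 * ln T + 61" "60 \<le> L" "2000000 * T\<^sup>2 * real L ^ 2 \<le> 2 ^ L"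
proof -
  show T: "1 \<le> T" using s \<epsilon> by (simp add: T_def field_simps)
  show "real s \<le> T" using s \<epsilon> by (simp add: T_def field_simps mult_left_le)
  have "0 \<le> 4 * ln T" using T by simp
  from nat_ceiling_bounds[OF this] have L: "4 * ln T + 60 \<le> real L" "real L \<le> 4 * ln T + 61"
    by (simp_all add: L_def gate_width_def T_def)
  show "real L \<le> 4 * ln T + 61" by fact
  show L60: "60 \<le> L" by (simp add: L_def gate_width_def)
  have c: "ln (2000000 :: real) \<le> 22"
  proof -
    have "ln (1000000 :: real) = 3 * ln 100" using ln_realpow[of "100 :: real" 3] by simp
    moreover have "ln (2000000 :: real) = ln 2 + ln 1000000" using ln_mult_pos[of "2 :: real" 1000000] by simp
    ultimately show ?thesis using ln_100_le ln_2_less_1 by simp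
  qed
  \<comment> \<open>Slope 1 / 12 is what remains: 2 * ln T takes L / 2 of the available 2 / 3 * L,
    because ln 2 \<ge> 2 / 3, and 2 * ln L may take L / 6. The constants then sum to 22 - 30 + 5 <
    0.\<close>
  have "ln (real L) = ln (real L / 12) + ln 12" using L60 by (simp add: ln_div)
  also have "ln (real L / 12) \<le> real L / 12 - 1" using L60 by (intro ln_le_minus_one) simp
  also have "ln (12 :: real) \<le> 7 / 2"
  proof -
    have "ln (8 :: real) = 3 * ln 2" using ln_realpow[of "2 :: real" 3] by simp
    moreover have "ln (12 :: real) = ln 8 + ln (3 / 2)" using ln_mult_pos[of "8 :: real" "3 / 2"] by simp
    moreover have "ln (3 / 2 :: real) \<le> 3 / 2 - 1" by (rule ln_le_minus_one) simp
    ultimately show ?thesis using ln_2_less_1 by simp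
  qed
  finally have lnL: "ln (real L) \<le> real L / 12 + 5 / 2" by simp
  have "ln (2000000 * T\<^sup>2 * real L ^ 2) = ln 2000000 + 2 * ln T + 2 * ln (real L)"
    using T L60 by (simp add: ln_mult_pos ln_realpow)
  also have "\<dots> \<le> 2 / 3 * real L" using c lnL L L60 by simp
  also have "\<dots> \<le> ln 2 * real L" using ln2_ge_two_thirds by (intro mult_right_mono) auto
  also have "\<dots> = ln (2 ^ L)" by (simp add: ln_realpow)
  finally show "2000000 * T\<^sup>2 * real L ^ 2 \<le> 2 ^ L"
    using T L60 by (subst (asm) ln_le_cancel_iff) auto
qed

lemma node_bound_le:
  assumes "1 \<le> s"
  shows "real (node_bound s \<epsilon>) \<le> 4 * real s * real (gate_width s \<epsilon>)"
proof -
  have "node_bound s \<epsilon> \<le> 4 * s * gate_width s \<epsilon>"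
  proof -
    have "s * 1 \<le> s * gate_width s \<epsilon>" by (rule mult_le_mono2) (simp add: gate_width_def)
    moreover have "node_bound s \<epsilon> = 2 * (s * gate_width s \<epsilon>) + s + 1" by (simp add: node_bound_def algebra_simps)
    ultimately show ?thesis using assms by linarith
  qed
  then have "real (node_bound s \<epsilon>) \<le> real (4 * s * gate_width s \<epsilon>)" by (simp only: of_nat_le_iff)
  then show ?thesis by simp
qed

lemma num_queries_le:
  assumes s: "1 \<le> s" and \<epsilon>: "0 < \<epsilon>" "\<epsilon> \<le> 1"
  shows "real (num_samples s \<epsilon> + 2 * num_pairs \<epsilon>) \<le> 470000 * (real s / \<epsilon>) * real (gate_width s \<epsilon>) ^ 2"
proof -
  define T L where "T = real s / \<epsilon>" and "L = real (gate_width s \<epsilon>)"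
  note b = gate_width_bounds[OF assms]
  have L: "60 \<le> L" and T: "1 \<le> T" using b unfolding L_def T_def by simp_all
  have L2: "1 \<le> L\<^sup>2" using L by (intro one_le_power) simp
  then have TL: "T \<le> T * L\<^sup>2" using T mult_left_mono[of 1 "L\<^sup>2" T] by simp
  have e: "1 / \<epsilon> \<le> T" using s \<epsilon> by (simp add: T_def divide_right_mono)
  have "7 + 2 * real (node_bound s \<epsilon>) * (L + 3) \<le> 7 * (real s * L\<^sup>2) + 2 * (4 * real s * L) * (2 * L)"
  proof (intro add_mono mult_mono)
    show "7 \<le> 7 * (real s * L\<^sup>2)" using s L2 mult_mono[of 1 "real s" 1 "L\<^sup>2"] by simp
  qed (use L node_bound_le[OF s, of \<epsilon>] in \<open>auto simp: L_def\<close>)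
  also have "\<dots> = 23 * (real s * L\<^sup>2)" by (simp add: power2_eq_square)
  finally have "(7 + 2 * real (node_bound s \<epsilon>) * (L + 3)) * 20000 / \<epsilon> \<le> 23 * (real s * L\<^sup>2) * 20000 / \<epsilon>"
    using \<epsilon> by (intro divide_right_mono mult_right_mono) auto
  also have "\<dots> = 460000 * (T * L\<^sup>2)" by (simp add: T_def)
  finally have X: "(7 + 2 * real (node_bound s \<epsilon>) * (L + 3)) * 20000 / \<epsilon> \<le> 460000 * (T * L\<^sup>2)" .
  have "0 \<le> (7 + 2 * real (node_bound s \<epsilon>) * (L + 3)) * 20000 / \<epsilon>" using L \<epsilon> by simp
  from conjunct2[OF nat_ceiling_bounds[OF this]] X
  have m: "real (num_samples s \<epsilon>) \<le> 460000 * (T * L\<^sup>2) + 1"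
    unfolding num_samples_def L_def of_nat_add of_nat_numeral by linarith
  have t: "real (num_pairs \<epsilon>) \<le> 480 * T + 1"
  proof -
    have "0 \<le> 480 / \<epsilon>" using \<epsilon> by simp
    from conjunct2[OF nat_ceiling_bounds[OF this]] e show ?thesis unfolding num_pairs_def by linarith
  qed
  have "real (num_samples s \<epsilon> + 2 * num_pairs \<epsilon>) \<le> 460000 * (T * L\<^sup>2) + 1 + 2 * (480 * T + 1)"
    using m t by simp
  also have "\<dots> \<le> 470000 * (T * L\<^sup>2)" using TL T by argo
  finally show ?thesis by (simp add: T_def L_def mult.assoc)
qed

lemma node_bound_square_le:
  assumes "1 \<le> s" "0 < \<epsilon>" "\<epsilon> \<le> 1"
  shows "400 * (node_bound s \<epsilon>)\<^sup>2 \<le> 2 ^ gate_width s \<epsilon>"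
proof -
  note b = gate_width_bounds[OF assms]
  have "real (400 * (node_bound s \<epsilon>)\<^sup>2) \<le> 400 * (4 * real s * real (gate_width s \<epsilon>))\<^sup>2"
    using node_bound_le[OF assms(1), of \<epsilon>] by (simp add: power_mono)
  also have "\<dots> = 6400 * (real s)\<^sup>2 * real (gate_width s \<epsilon>) ^ 2" by (simp add: power_mult_distrib)
  also have "\<dots> \<le> 2000000 * (real s / \<epsilon>)\<^sup>2 * real (gate_width s \<epsilon>) ^ 2"
    using b(2) by (intro mult_mono power_mono) auto
  also have "\<dots> \<le> 2 ^ gate_width s \<epsilon>" by (rule b(5))
  finally have "real (400 * (node_bound s \<epsilon>)\<^sup>2) \<le> real (2 ^ gate_width s \<epsilon>)" by simp
  then show ?thesis by (simp only: of_nat_le_iff)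
qed

lemma ln_num_hyps_le:
  assumes "1 \<le> s" "0 < \<epsilon>" "\<epsilon> \<le> 1"
  shows "ln (100 * real ((2 * 2 ^ gate_width s \<epsilon> + 4) ^ (2 * node_bound s \<epsilon>))) \<le> \<epsilon> / 20000 * real (num_samples s \<epsilon>)"
proof -
  let ?L = "gate_width s \<epsilon>" and ?W = "node_bound s \<epsilon>"
  have pos: "0 < (2 * 2 ^ ?L + 4 :: real)" by (intro add_pos_pos) auto
  have "(2 * 2 ^ ?L + 4 :: real) \<le> 2 ^ (?L + 3)"
  proof -
    have "(2 :: real) ^ (?L + 3) = 8 * 2 ^ ?L" by (simp add: power_add)
    moreover have "(1 :: real) \<le> 2 ^ ?L" by (rule one_le_power) simp
    ultimately show ?thesis by linarith
  qed
  then have "ln (2 * 2 ^ ?L + 4 :: real) \<le> ln (2 ^ (?L + 3))" using pos by simp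
  also have "\<dots> = real (?L + 3) * ln 2" by (rule ln_realpow)
  also have "\<dots> \<le> real (?L + 3) * 1" using ln_2_less_1 by (intro mult_left_mono) auto
  finally have l: "ln (2 * 2 ^ ?L + 4 :: real) \<le> real (?L + 3)" by simp
  have "ln (100 * real ((2 * 2 ^ ?L + 4) ^ (2 * ?W))) = ln 100 + real (2 * ?W) * ln (2 * 2 ^ ?L + 4)"
    using pos by (simp add: ln_mult_pos ln_realpow)
  also have "\<dots> \<le> 7 + real (2 * ?W) * real (?L + 3)"
    by (intro add_mono mult_left_mono l ln_100_le) auto
  also have "\<dots> = \<epsilon> / 20000 * ((7 + 2 * real ?W * real (?L + 3)) * 20000 / \<epsilon>)"
    using assms by (simp add: field_simps)
  also have "\<dots> \<le> \<epsilon> / 20000 * real (num_samples s \<epsilon>)"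
    using assms unfolding num_samples_def
    by (intro mult_left_mono conjunct1[OF nat_ceiling_bounds]) auto
  finally show ?thesis .
qed

theorem theorem18:
  "\<exists>(A :: real \<Rightarrow> nat \<Rightarrow> nat \<Rightarrow> algorithm) (q :: nat \<Rightarrow> real \<Rightarrow> nat).
     (\<lambda>(s, \<epsilon>). real (q s \<epsilon>))
       \<in> soft_O (principal {(s, \<epsilon>). 1 \<le> s \<and> 0 < \<epsilon>}) (\<lambda>(s, \<epsilon>). real s / \<epsilon>) \<and>
     (\<forall>\<epsilon>>0. \<forall>s\<ge>1. \<forall>n.
        two_sided_tester n \<epsilon> (formula_class n s) (A \<epsilon> s n) \<and>
        queries_at_most n (A \<epsilon> s n) (q s \<epsilon>))"
proof -
  let ?H = "\<lambda>\<epsilon> s. hyps (2 ^ gate_width s \<epsilon>) (node_bound s \<epsilon>) s"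
  \<comment> \<open>No formula exists over 0 variables, so the class is empty and rejection is
    right. For \<epsilon> > 1 no function is far, because the class contains a constant.\<close>
  define A where "A \<epsilon> s n = (if n = 0 then Answer False else if \<epsilon> > 1 then Answer True
     else tester n (gate_width s \<epsilon>) (num_samples s \<epsilon>) (num_pairs \<epsilon>) (?H \<epsilon> s))" for \<epsilon> s n
  \<comment> \<open>For \<epsilon> > 1 the ratio s / \<epsilon> may be tiny, and the polynomial
    chosen below even vanishes for one such ratio; zero queries satisfy the bound there.\<close>
  define q where "q s \<epsilon> = (if \<epsilon> > 1 then 0 else num_samples s \<epsilon> + 2 * num_pairs \<epsilon>)" for s \<epsilon>
  have "(\<lambda>(s, \<epsilon>). real (q s \<epsilon>)) \<in>
      O[principal {(s, \<epsilon>). 1 \<le> s \<and> 0 < \<epsilon>}](\<lambda>x. (case x of (s, \<epsilon>) \<Rightarrow> real s / \<epsilon>) *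
        poly ([:61, 4:]\<^sup>2) (ln (case x of (s, \<epsilon>) \<Rightarrow> real s / \<epsilon>)))"
  proof (rule bigoI[where c = 470000], unfold eventually_principal, rule ballI)
    fix x :: "nat \<times> real" assume "x \<in> {(s, \<epsilon>). 1 \<le> s \<and> 0 < \<epsilon>}"
    then obtain s \<epsilon> where x: "x = (s, \<epsilon>)" "1 \<le> s" "0 < \<epsilon>" by auto
    have "real (q s \<epsilon>) \<le> 470000 * ((real s / \<epsilon>) * (61 + 4 * ln (real s / \<epsilon>))\<^sup>2)"
    proof (cases "\<epsilon> > 1")
      case True
      then show ?thesis using x by (simp add: q_def)
    next
      case False
      then have \<epsilon>: "\<epsilon> \<le> 1" by simp
      have "real (q s \<epsilon>) \<le> 470000 * (real s / \<epsilon>) * real (gate_width s \<epsilon>) ^ 2"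
        using num_queries_le[OF x(2,3) \<epsilon>] False by (simp add: q_def)
      also have "\<dots> \<le> 470000 * (real s / \<epsilon>) * (61 + 4 * ln (real s / \<epsilon>))\<^sup>2"
        using gate_width_bounds(3)[OF x(2,3) \<epsilon>] x by (intro mult_left_mono power_mono) auto
      finally show ?thesis by (simp add: mult.assoc)
    qed
    then show "norm (case x of (s, \<epsilon>) \<Rightarrow> real (q s \<epsilon>)) \<le> 470000 * norm ((case x of (s, \<epsilon>) \<Rightarrow> real s / \<epsilon>) *
        poly ([:61, 4:]\<^sup>2) (ln (case x of (s, \<epsilon>) \<Rightarrow> real s / \<epsilon>)))"
      using x by (simp add: poly_power abs_mult mult.commute[of 4])
  qed
  then have soft: "(\<lambda>(s, \<epsilon>). real (q s \<epsilon>))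
       \<in> soft_O (principal {(s, \<epsilon>). 1 \<le> s \<and> 0 < \<epsilon>}) (\<lambda>(s, \<epsilon>). real s / \<epsilon>)"
    unfolding soft_O_def by blast
  have queries: "queries_at_most n (A \<epsilon> s n) (q s \<epsilon>)" for \<epsilon> s n
    using queries_tester by (simp add: A_def q_def queries_at_most.intros)
  have test: "two_sided_tester n \<epsilon> (formula_class n s) (A \<epsilon> s n)" if \<epsilon>: "0 < \<epsilon>" and s: "1 \<le> s" for \<epsilon> s n
  proof (cases "n = 0")
    case True
    then show ?thesis
      by (simp add: two_sided_tester_def A_def formula_class_def formula_over_0)
  next
    case n0: False
    then have n: "1 \<le> n" by simp
    show ?thesis
    proof (cases "\<epsilon> > 1")
      case True
      have "\<not> far n \<epsilon> f (formula_class n s)" for f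
      proof
        assume "far n \<epsilon> f (formula_class n s)"
        then have "\<epsilon> \<le> dist_unif n f (\<lambda>x. True)"
          using const_in_formula_class[OF n s] by (simp add: far_def)
        also have "\<dots> \<le> 1" by (simp add: dist_unif_def)
        finally show False using True by simp
      qed
      then show ?thesis using True n0 by (simp add: two_sided_tester_def A_def)
    next
      case False
      then have \<epsilon>1: "\<epsilon> \<le> 1" by simp
      let ?L = "gate_width s \<epsilon>" and ?W = "node_bound s \<epsilon>" and ?m = "num_samples s \<epsilon>" and ?t = "num_pairs \<epsilon>"
      let ?N = "real ((2 * 2 ^ ?L + 4) ^ (2 * ?W))"
      have A: "A \<epsilon> s n = tester n ?L ?m ?t (?H \<epsilon> s)" using False n0 by (simp add: A_def)
      note r = node_bound_square_le[OF s \<epsilon> \<epsilon>1] and N = ln_num_hyps_le[OF s \<epsilon> \<epsilon>1]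
      have cardH: "real (card (?H \<epsilon> s)) \<le> ?N"
        using card_hyps[of "2 ^ ?L" ?W s] by (simp only: of_nat_le_iff)
      have "real 1 \<le> ?N" unfolding of_nat_le_iff by (rule one_le_power) simp
      then have N1: "1 \<le> ?N" by (simp only: of_nat_1)
      have t: "480 / \<epsilon> \<le> real ?t" "real ?t \<le> 480 / \<epsilon> + 1"
        using nat_ceiling_bounds[of "480 / \<epsilon>"] \<epsilon> by (simp_all add: num_pairs_def)
      have accept: "2 / 3 \<le> pmf (run (A \<epsilon> s n) f) True" if "f \<in> formula_class n s" for f
      proof -
        obtain \<phi> where \<phi>: "formula_over n \<phi>" "formula_size \<phi> \<le> s" "\<forall>x\<in>cube n. f x = eval_formula \<phi> x"
          using \<open>f \<in> formula_class n s\<close> unfolding formula_class_def by blast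
        let ?\<phi> = "narrow ?L \<phi>" and ?\<eta> = "real s * (1 / 2) ^ ?L"
        have vars: "fvars \<phi> \<subseteq> {..<n}" by (rule fvars_formula_over[OF \<phi>(1)])
        have "Pr (unif n) (\<lambda>x. f x \<noteq> eval_formula ?\<phi> x) = Pr (unif n) (\<lambda>x. eval_formula \<phi> x \<noteq> eval_formula ?\<phi> x)"
          by (rule Pr_cong) (use \<phi>(3) in simp)
        also have "\<dots> \<le> real (formula_size \<phi>) * (1 / 2) ^ ?L" by (rule dist_narrow[OF vars])
        also have "\<dots> \<le> ?\<eta>" using \<phi>(2) by (intro mult_right_mono) auto
        finally have \<eta>: "Pr (unif n) (\<lambda>x. f x \<noteq> eval_formula ?\<phi> x) \<le> ?\<eta>" .
        have "nodes ?\<phi> \<le> (2 * ?L + 1) * formula_size \<phi> + 1"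
          by (rule order_trans[OF nodes_narrow]) simp
        also have "\<dots> \<le> ?W" unfolding node_bound_def using \<phi>(2) by (intro add_right_mono mult_left_mono) auto
        finally have nodes: "nodes ?\<phi> \<le> ?W" .
        have "Pr (samples n (2 ^ ?L) ?m ?t) (\<lambda>\<omega>. \<not> accepts n (?H \<epsilon> s) f \<omega>) \<le>
            1 / 400 + (real ?m * ?\<eta> + 1 / 100 + real ?t * (2 * (\<epsilon> / 20000 + ?\<eta>)))"
          by (rule completeness[OF r _ order_trans[OF fvars_narrow vars] nodes
                order_trans[OF gsize_narrow \<phi>(2)] \<eta> cardH N1 N]) (use \<epsilon> in simp_all)
        also have "\<dots> = 1 / 400 + 1 / 100 + real ?t * \<epsilon> / 10000 + real (?m + 2 * ?t) * ?\<eta>"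
          by (simp add: algebra_simps)
        \<comment> \<open>The pairs cost 2 * \<alpha> * t, at most 481 / 10000; the queries that may
          hit a wide gate cost 1 / 4. The sum is about 0.311.\<close>
        also have "\<dots> \<le> 1 / 400 + 1 / 100 + 481 / 10000 + 1 / 4"
        proof (intro add_mono order_refl)
          have "real ?t * \<epsilon> \<le> (480 / \<epsilon> + 1) * \<epsilon>" using t \<epsilon> by (intro mult_right_mono) auto
          also have "\<dots> \<le> 481" using \<epsilon> \<epsilon>1 by (simp add: field_simps)
          finally show "real ?t * \<epsilon> / 10000 \<le> 481 / 10000" by simp
          note b = gate_width_bounds[OF s \<epsilon> \<epsilon>1]
          have "real (?m + 2 * ?t) * real s \<le> (470000 * (real s / \<epsilon>) * real ?L ^ 2) * (real s / \<epsilon>)"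
            using num_queries_le[OF s \<epsilon> \<epsilon>1] b(2) by (intro mult_mono) auto
          also have "\<dots> = 470000 * ((real s / \<epsilon>)\<^sup>2 * real ?L ^ 2)" by (simp add: power2_eq_square)
          also have "\<dots> \<le> 500000 * ((real s / \<epsilon>)\<^sup>2 * real ?L ^ 2)" by (intro mult_right_mono) auto
          also have "\<dots> \<le> 2 ^ ?L / 4" using b(5) by simp
          finally show "real (?m + 2 * ?t) * ?\<eta> \<le> 1 / 4"
            by (simp add: power_divide field_simps)
        qed
        also have "\<dots> \<le> 1 / 3" by simp
        finally show ?thesis
          unfolding A pmf_run_tester_True by (simp add: Pr_not)
      qed
      have reject: "2 / 3 \<le> pmf (run (A \<epsilon> s n) f) False" if far: "far n \<epsilon> f (formula_class n s)" for f
      proof -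
        have farf: "\<epsilon> \<le> Pr (unif n) (\<lambda>x. f x \<noteq> eval_formula \<phi> x)"
          if "fvars \<phi> \<subseteq> {..<n}" "gsize \<phi> \<le> s" for \<phi>
          using far eval_in_formula_class[OF n s that] unfolding far_def dist_unif_def by blast
        have "Pr (samples n (2 ^ ?L) ?m ?t) (accepts n (?H \<epsilon> s) f) \<le> 1 / 3"
        \<comment> \<open>With \<delta> = \<epsilon> / 12, \<epsilon> - 6 * \<delta> = \<epsilon> /
          2 leaves ample room for the accuracy \<epsilon> / 20000.\<close>
        proof (cases "\<exists>g. junta n ?W g \<and> Pr (unif n) (\<lambda>x. f x \<noteq> g x) \<le> \<epsilon> / 12")
          case True
          then obtain g where g: "junta n ?W g" "Pr (unif n) (\<lambda>x. f x \<noteq> g x) \<le> \<epsilon> / 12" by blast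
          have "Pr (samples n (2 ^ ?L) ?m ?t) (accepts n (?H \<epsilon> s) f) \<le> 1 / 400 + (1 / 5 + 1 / 100)"
            by (rule soundness_near_junta[OF r _ g _ farf cardH N1 N]) (use \<epsilon> in simp_all)
          then show ?thesis by simp
        next
          case False
          have "ln 100 \<le> \<epsilon> / 12 / 4 * (480 / \<epsilon>)" using ln_100_le \<epsilon> by simp
          also have "\<dots> \<le> \<epsilon> / 12 / 4 * real ?t" using t \<epsilon> by (intro mult_left_mono) auto
          finally have lnt: "ln 100 \<le> \<epsilon> / 12 / 4 * real ?t" .
          have "Pr (samples n (2 ^ ?L) ?m ?t) (accepts n (?H \<epsilon> s) f) \<le> 1 / 100 + 1 / 100"
          proof (rule soundness_far_from_junta[OF r _ _ _ lnt])
            show "?H \<epsilon> s \<subseteq> small_formulas (2 ^ ?L) ?W" by (auto simp: hyps_def)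
            show "\<epsilon> / 12 \<le> Pr (unif n) (\<lambda>x. f x \<noteq> g x)" if "junta n ?W g" for g
              using False that by force
          qed (simp add: node_bound_def)
          then show ?thesis by simp
        qed
        then show ?thesis
          unfolding A pmf_False_conv_True pmf_run_tester_True by simp
      qed
      show ?thesis unfolding two_sided_tester_def using accept reject by blast
    qed
  qed
  show ?thesis using soft queries test by blast
qed

end
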